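(* Let $n,d\ge 1$ be integers. If $d$ complete flags $E^1_\bullet,\dots,E^d_\bullet$ in $\mathbb{C}^n$ are generic enough, then the matroid of linear dependence of the $\binom{n+d-2}{d-1}$ lines $E_{a_1,\dots,a_d}=E^1_{a_1}\cap\cdots\cap E^d_{a_d}$, where $1\le a_i\le n$ and $a_1+\cdots+a_d=(d-1)n+1$, is isomorphic to $\mathcal{T}_{n,d}$, the line $E_{a_1,\dots,a_d}$ corresponding to the point $(n-a_1,\dots,n-a_d)\in T_{n,d}$.
   Context: A complete flag $E_\bullet$ in $\mathbb{C}^n$ is a chain $\{0\}=E_0\subset E_1\subset\cdots\subset E_n=\mathbb{C}^n$ with $\dim E_i=i$. "Generic enough" means: for all $d$-tuples of flags in some nonempty Zariski-open subset of $(\mathcal{F}\ell_n)^d$, where $\mathcal{F}\ell_n$ is the variety of complete flags in $\mathbb{C}^n$; in particular the $E_{a_1,\dots,a_d}$ above are one-dimensional. Let $T_{n,d}=\{x\in\mathbb{Z}_{\ge 0}^d : x_1+\cdots+x_d=n-1\}$. For $1\le k\le n$ and nonnegative integers $a_1,\dots,a_d$ with $\sum a_i=n-k$, the set $\{x\in T_{n,d}: x_i\ge a_i\ \forall i\}$ is called a simplex of size $k$ in $T_{n,d}$. $\mathcal{T}_{n,d}$ is the matroid on ground set $T_{n,d}$ whose independent sets are the subsets $I\subseteq T_{n,d}$ such that every simplex of size $k$ contains at most $k$ points of $I$, for every $k\le n$. A set of lines through the origin is independent if choosing a nonzero vector in each line gives linearly independent vectors. *)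

theory Defs
  imports "HOL-Analysis.Analysis"
begin

section \<open>Matroids\<close>

text \<open>A matroid is given by its ground set and its family of independent sets.\<close>

definition matroid :: "'a set \<times> 'a set set \<Rightarrow> bool" where
  "matroid M \<longleftrightarrow> (case M of (S, \<I>) \<Rightarrow>
     finite S \<and> \<I> \<subseteq> Pow S \<and> {} \<in> \<I> \<and>
     (\<forall>X\<in>\<I>. \<forall>Y. Y \<subseteq> X \<longrightarrow> Y \<in> \<I>) \<and>
     (\<forall>X\<in>\<I>. \<forall>Y\<in>\<I>. card X < card Y \<longrightarrow> (\<exists>y\<in>Y - X. insert y X \<in> \<I>)))"

definition matroid_isomorphism ::
    "('a \<Rightarrow> 'b) \<Rightarrow> 'a set \<times> 'a set set \<Rightarrow> 'b set \<times> 'b set set \<Rightarrow> bool" where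
  "matroid_isomorphism \<phi> M N \<longleftrightarrow>
     matroid M \<and> matroid N \<and> bij_betw \<phi> (fst M) (fst N) \<and>
     (\<forall>X. X \<subseteq> fst M \<longrightarrow> (X \<in> snd M \<longleftrightarrow> \<phi> ` X \<in> snd N))"


section \<open>The matroid \<open>\<T>\<^sub>n\<^sub>,\<^sub>d\<close>\<close>

text \<open>The \<open>d\<close> coordinates are indexed by a finite type \<open>'d\<close> with \<open>CARD('d) = d\<close>.\<close>

definition T_points :: "nat \<Rightarrow> ('d::finite \<Rightarrow> nat) set" where
  "T_points n = {x. (\<Sum>i\<in>UNIV. x i) + 1 = n}"

definition T_simplices :: "nat \<Rightarrow> nat \<Rightarrow> ('d::finite \<Rightarrow> nat) set set" where
  "T_simplices n k = {{x \<in> T_points n. \<forall>i. a i \<le> x i} | a. (\<Sum>i\<in>UNIV. a i) + k = n}"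

definition T_matroid :: "nat \<Rightarrow> ('d::finite \<Rightarrow> nat) set \<times> ('d \<Rightarrow> nat) set set" where
  "T_matroid n = (T_points n,
     {I. I \<subseteq> T_points n \<and>
         (\<forall>k\<in>{1..n}. \<forall>\<Delta>\<in>T_simplices n k. card (I \<inter> \<Delta>) \<le> k)})"


section \<open>Complete flags and genericity\<close>

text \<open>A flag in \<open>\<complex>\<^sup>n\<close>, \<open>n = CARD('n)\<close>, is a sequence of complex subspaces
  (\<open>vec.subspace\<close>, \<open>vec.dim\<close>, \<open>vec.span\<close> refer to the complex scalar multiplication).
  Only the members with index at most \<open>n\<close> carry information; those beyond are
  fixed to be the whole space, so that distinct sequences are distinct flags.\<close>

definition complete_flag :: "(nat \<Rightarrow> (complex^'n) set) \<Rightarrow> bool" where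
  "complete_flag E \<longleftrightarrow>
     E 0 = {0} \<and> (\<forall>k\<ge>CARD('n). E k = UNIV) \<and>
     (\<forall>k<CARD('n). E k \<subset> E (Suc k)) \<and>
     (\<forall>k\<le>CARD('n). vec.subspace (E k) \<and> vec.dim (E k) = k)"

text \<open>An ordered basis \<open>b 0, \<dots>, b (n - 1)\<close> is the same thing as an element of \<open>GL\<^sub>n\<close>
  (its list of columns); values of \<open>b\<close> beyond \<open>n - 1\<close> are irrelevant.\<close>

definition ordered_basis :: "(nat \<Rightarrow> complex^'n) \<Rightarrow> bool" where
  "ordered_basis b \<longleftrightarrow> inj_on b {..<CARD('n)} \<and> vec.independent (b ` {..<CARD('n)})"

definition flag_of_basis :: "(nat \<Rightarrow> complex^'n) \<Rightarrow> nat \<Rightarrow> (complex^'n) set" where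
  "flag_of_basis b k = vec.span (b ` {..<min k CARD('n)})"

text \<open>Polynomials in the entries of a tuple, indexed by \<open>'d\<close>, of \<open>n \<times> n\<close> matrices.\<close>

inductive polynomial_in_entries :: "(('d \<Rightarrow> nat \<Rightarrow> complex^'n) \<Rightarrow> complex) \<Rightarrow> bool" where
  const: "polynomial_in_entries (\<lambda>b. c)"
| entry: "i < CARD('n) \<Longrightarrow> polynomial_in_entries (\<lambda>b. b j i $ l)"
| add: "polynomial_in_entries p \<Longrightarrow> polynomial_in_entries q \<Longrightarrow> polynomial_in_entries (\<lambda>b. p b + q b)"
| mult: "polynomial_in_entries p \<Longrightarrow> polynomial_in_entries q \<Longrightarrow> polynomial_in_entries (\<lambda>b. p b * q b)"

text \<open>The flag variety is the homogeneous space \<open>GL\<^sub>n / B\<close>, where \<open>B\<close> is the group of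
  upper triangular matrices, and the \<open>d\<close>-fold product of flag varieties is
  \<open>(GL\<^sub>n)\<^sup>d / B\<^sup>d\<close>. Its Zariski topology is the quotient topology: a set of tuples of flags is
  open iff its preimage in \<open>(GL\<^sub>n)\<^sup>d\<close> is, that is, iff the preimage is the complement in
  \<open>(GL\<^sub>n)\<^sup>d\<close> of the common zero set of some set \<open>P\<close> of polynomials.\<close>

definition zariski_open_flags :: "('d \<Rightarrow> nat \<Rightarrow> (complex^'n) set) set \<Rightarrow> bool" where
  "zariski_open_flags U \<longleftrightarrow>
     (\<forall>E\<in>U. \<forall>j. complete_flag (E j)) \<and>
     (\<exists>P. (\<forall>p\<in>P. polynomial_in_entries p) \<and>
          (\<forall>b. (\<forall>j. ordered_basis (b j)) \<longrightarrow>
               ((\<lambda>j. flag_of_basis (b j)) \<in> U \<longleftrightarrow> (\<exists>p\<in>P. p b \<noteq> 0))))"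

definition for_generic_flags :: "(('d \<Rightarrow> nat \<Rightarrow> (complex^'n) set) \<Rightarrow> bool) \<Rightarrow> bool" where
  "for_generic_flags Q \<longleftrightarrow> (\<exists>U. zariski_open_flags U \<and> U \<noteq> {} \<and> (\<forall>E\<in>U. Q E))"


section \<open>The lines of a flag arrangement and their matroid\<close>

definition line_indices :: "nat \<Rightarrow> ('d::finite \<Rightarrow> nat) set" where
  "line_indices n = {a. (\<forall>i. 1 \<le> a i \<and> a i \<le> n) \<and> (\<Sum>i\<in>UNIV. a i) = (CARD('d) - 1) * n + 1}"

definition flag_meet :: "('d \<Rightarrow> nat \<Rightarrow> (complex^'n) set) \<Rightarrow> ('d \<Rightarrow> nat) \<Rightarrow> (complex^'n) set" where
  "flag_meet E a = (\<Inter>j. E j (a j))"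

definition flag_lines :: "('d::finite \<Rightarrow> nat \<Rightarrow> (complex^'n) set) \<Rightarrow> (complex^'n) set set" where
  "flag_lines E = flag_meet E ` line_indices CARD('n)"

definition independent_lines :: "(complex^'n) set set \<Rightarrow> bool" where
  "independent_lines L \<longleftrightarrow>
     (\<forall>v. (\<forall>l\<in>L. v l \<in> l \<and> v l \<noteq> 0) \<longrightarrow> inj_on v L \<and> vec.independent (v ` L))"

definition line_matroid :: "(complex^'n) set set \<Rightarrow> (complex^'n) set set \<times> (complex^'n) set set set" where
  "line_matroid S = (S, {L. L \<subseteq> S \<and> independent_lines L})"

end

theory Submission
  imports Defs "HOL-Computational_Algebra.Polynomial"
begin

text \<open>Describe the flags dually: \<open>E\<^sup>j\<^sub>k\<close> is the common kernel of covectors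
  \<open>f j i\<close>, \<open>i < n - k\<close>. The line of a point \<open>x\<close> is then the annihilator of the \<open>n - 1\<close>
  covectors \<open>f j i\<close>, \<open>i < x j\<close>, and more than \<open>k\<close> lines in a simplex of size \<open>k\<close> are
  dependent because they lie in the annihilator of \<open>n - k\<close> independent covectors.
  Conversely, let \<open>I\<close> be independent in \<open>\<T>\<^sub>n\<^sub>,\<^sub>d\<close> and give its points distinct
  coordinates \<open>\<sigma> x\<close>. Setting the entry \<open>\<sigma> x\<close> of \<open>f j i\<close> to zero whenever
  \<open>i < x j\<close> puts the coordinate vector \<open>\<sigma> x\<close> on the line of \<open>x\<close>. With the other
  entries generic, Hall's theorem shows that the \<open>n - 1\<close> covectors of \<open>x\<close> are still
  independent, so the lines of \<open>I\<close> are distinct coordinate axes. Independence is an open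
  condition, polynomial in \<open>f\<close> by Cramer's rule, and finitely many nonempty open conditions
  hold simultaneously.\<close>

section \<open>Polynomials in the entries\<close>

lemma polynomial_in_entries_sum:
  "(\<And>i. i \<in> S \<Longrightarrow> polynomial_in_entries (p i)) \<Longrightarrow> polynomial_in_entries (\<lambda>b. \<Sum>i\<in>S. p i b)"
  by (induction S rule: infinite_finite_induct) (auto intro: polynomial_in_entries.intros)

lemma polynomial_in_entries_prod:
  "(\<And>i. i \<in> S \<Longrightarrow> polynomial_in_entries (p i)) \<Longrightarrow> polynomial_in_entries (\<lambda>b. \<Prod>i\<in>S. p i b)"
  by (induction S rule: infinite_finite_induct) (auto intro: polynomial_in_entries.intros)

lemma polynomial_in_entries_det:
  fixes M :: "('d \<Rightarrow> nat \<Rightarrow> complex^'n) \<Rightarrow> complex^'m^'m"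
  assumes "\<And>i k. polynomial_in_entries (\<lambda>b. M b $ i $ k)"
  shows "polynomial_in_entries (\<lambda>b. det (M b))"
  unfolding det_def
  by (intro polynomial_in_entries_sum polynomial_in_entries.mult polynomial_in_entries_prod
      polynomial_in_entries.const assms)

lemma polynomial_in_entries_compose:
  fixes g :: "('d \<Rightarrow> nat \<Rightarrow> complex^'n) \<Rightarrow> 'e \<Rightarrow> nat \<Rightarrow> complex^'n"
  assumes "polynomial_in_entries q"
    and "\<And>j i l. i < CARD('n) \<Longrightarrow> polynomial_in_entries (\<lambda>b. g b j i $ l)"
  shows "polynomial_in_entries (\<lambda>b. q (g b))"
  using assms(1) by induction (auto intro: polynomial_in_entries.intros assms(2))

text \<open>The rule \<open>entry\<close> admits only indices below \<open>CARD('n)\<close>, so the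
  irrelevant tail of a tuple may be changed freely.\<close>

lemma polynomial_in_entries_cong:
  fixes b c :: "'d \<Rightarrow> nat \<Rightarrow> complex^'n"
  assumes "polynomial_in_entries q" and "\<And>j i. i < CARD('n) \<Longrightarrow> b j i = c j i"
  shows "q b = q c"
  using assms(1) by induction (auto simp: assms(2))

text \<open>Restriction to the affine line through two tuples reduces genericity to root counting in
  one variable.\<close>

lemma polynomial_in_entries_line:
  assumes "polynomial_in_entries q"
  shows "\<exists>P. \<forall>t. q (\<lambda>j i. b j i + t *s (c j i - b j i)) = poly P t"
  using assms
proof induction
  case (const a)
  then show ?case by (intro exI[of _ "[:a:]"]) simp
next
  case (entry i j l)
  then show ?case by (intro exI[of _ "[:b j i $ l, c j i $ l - b j i $ l:]"]) (simp add: algebra_simps)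
next
  case (add p q)
  then obtain P Q where "\<forall>t. p (\<lambda>j i. b j i + t *s (c j i - b j i)) = poly P t"
    "\<forall>t. q (\<lambda>j i. b j i + t *s (c j i - b j i)) = poly Q t" by blast
  then show ?case by (intro exI[of _ "P + Q"]) simp
next
  case (mult p q)
  then obtain P Q where "\<forall>t. p (\<lambda>j i. b j i + t *s (c j i - b j i)) = poly P t"
    "\<forall>t. q (\<lambda>j i. b j i + t *s (c j i - b j i)) = poly Q t" by blast
  then show ?case by (intro exI[of _ "P * Q"]) simp
qed

text \<open>This is the irreducibility of affine space. On the line from \<open>b\<close> to
  \<open>c\<close> the restriction of \<open>p\<close> is nonzero at 0 and that of \<open>q\<close>
  at 1, so their product has finitely many roots, while the field is infinite.\<close>

lemma polynomial_in_entries_common_nonzero: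
  assumes p: "polynomial_in_entries p" "p b \<noteq> 0" and q: "polynomial_in_entries q" "q c \<noteq> 0"
  shows "\<exists>a. p a \<noteq> 0 \<and> q a \<noteq> 0"
proof -
  let ?l = "\<lambda>t j i. b j i + t *s (c j i - b j i)"
  obtain P where P: "\<And>t. p (?l t) = poly P t"
    using polynomial_in_entries_line[OF p(1)] by blast
  obtain Q where Q: "\<And>t. q (?l t) = poly Q t"
    using polynomial_in_entries_line[OF q(1)] by blast
  have "P \<noteq> 0" using P[of 0] p(2) by auto
  moreover have "Q \<noteq> 0" using Q[of 1] q(2) by auto
  ultimately have "finite {t. poly (P * Q) t = 0}"
    by (intro poly_roots_finite) simp
  then obtain t where "poly (P * Q) t \<noteq> 0"
    using infinite_UNIV_char_0 by (metis (mono_tags, lifting) UNIV_eq_I mem_Collect_eq)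
  then show ?thesis using P[of t] Q[of t] by (intro exI[of _ "?l t"]) auto
qed

section \<open>Generic tuples in affine space\<close>

text \<open>Genericity in the affine space of all tuples, singular ones included: the condition
  holds on a nonempty principal open set. It is passed to flags only at the end.\<close>

definition generic_tuple :: "(('d \<Rightarrow> nat \<Rightarrow> complex^'n) \<Rightarrow> bool) \<Rightarrow> bool" where
  "generic_tuple Q \<longleftrightarrow>
     (\<exists>q. polynomial_in_entries q \<and> (\<exists>b. q b \<noteq> 0) \<and> (\<forall>b. q b \<noteq> 0 \<longrightarrow> Q b))"

lemma generic_tuple_mono: "generic_tuple Q \<Longrightarrow> (\<And>b. Q b \<Longrightarrow> R b) \<Longrightarrow> generic_tuple R"
  unfolding generic_tuple_def by blast

lemma generic_tuple_conj:
  assumes "generic_tuple Q" "generic_tuple R"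
  shows "generic_tuple (\<lambda>b. Q b \<and> R b)"
proof -
  obtain q r where q: "polynomial_in_entries q" "\<exists>b. q b \<noteq> 0" "\<forall>b. q b \<noteq> 0 \<longrightarrow> Q b"
    and r: "polynomial_in_entries r" "\<exists>b. r b \<noteq> 0" "\<forall>b. r b \<noteq> 0 \<longrightarrow> R b"
    using assms unfolding generic_tuple_def by blast
  then obtain a where "q a \<noteq> 0 \<and> r a \<noteq> 0"
    using polynomial_in_entries_common_nonzero by blast
  then show ?thesis unfolding generic_tuple_def
    using q r by (intro exI[of _ "\<lambda>b. q b * r b"]) (auto intro: polynomial_in_entries.mult)
qed

lemma generic_tuple_ball:
  assumes "finite S" "\<And>x. x \<in> S \<Longrightarrow> generic_tuple (Q x)"
  shows "generic_tuple (\<lambda>b. \<forall>x\<in>S. Q x b)"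
  using assms
proof (induction S)
  case empty
  show ?case unfolding generic_tuple_def
    by (intro exI[of _ "\<lambda>b. 1"]) (auto intro: polynomial_in_entries.const)
next
  case (insert x S)
  then have "generic_tuple (\<lambda>b. Q x b \<and> (\<forall>y\<in>S. Q y b))"
    by (intro generic_tuple_conj) auto
  then show ?case by (rule generic_tuple_mono) auto
qed

text \<open>One explicit witness \<open>b\<close> is enough; this is how every generic condition
  below arises.\<close>

lemma generic_tuple_det:
  fixes M :: "('d \<Rightarrow> nat \<Rightarrow> complex^'n) \<Rightarrow> complex^'m^'m"
  assumes "\<And>i k. polynomial_in_entries (\<lambda>b. M b $ i $ k)" and "det (M b) \<noteq> 0"
  shows "generic_tuple (\<lambda>b. det (M b) \<noteq> 0)"
  unfolding generic_tuple_def using polynomial_in_entries_det[of M] assms by blast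

section \<open>Hall's theorem\<close>

text \<open>Halmos and Vaughan: either every proper nonempty subfamily has a spare element,
  or a tight subfamily is matched first and the rest is matched in its complement.\<close>

theorem hall_marriage:
  fixes N :: "'a \<Rightarrow> 'b set"
  assumes "finite X" and "\<And>x. x \<in> X \<Longrightarrow> finite (N x)"
    and "\<And>A. A \<subseteq> X \<Longrightarrow> card A \<le> card (\<Union>x\<in>A. N x)"
  shows "\<exists>h. inj_on h X \<and> (\<forall>x\<in>X. h x \<in> N x)"
  using assms
proof (induction "card X" arbitrary: X N rule: less_induct)
  case less
  note fin = less.prems(1) and finN = less.prems(2) and hall = less.prems(3)
  have finU: "finite (\<Union>x\<in>A. N x)" if "A \<subseteq> X" for A
    using that fin finN by (meson finite_UN finite_subset subsetD)
  consider (empty) "X = {}" | (tight) A where "A \<subset> X" "A \<noteq> {}" "card (\<Union>x\<in>A. N x) \<le> card A"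
    | (spare) "X \<noteq> {}" "\<And>A. A \<subset> X \<Longrightarrow> A \<noteq> {} \<Longrightarrow> card A < card (\<Union>x\<in>A. N x)"
    by (metis not_le)
  then show ?case
  proof cases
    case empty
    then show ?thesis by simp
  next
    case tight
    let ?U = "\<Union>x\<in>A. N x"
    have cA: "card A < card X" using tight(1) fin by (rule psubset_card_mono[rotated])
    have AX: "A \<subseteq> X" using tight(1) by blast
    have finA: "finite A" using AX fin by (rule finite_subset)
    obtain g where g: "inj_on g A" "\<forall>x\<in>A. g x \<in> N x"
      using less.hyps[OF cA finA, of N] finN hall AX by (metis subset_iff subset_trans)
    have cX: "card (X - A) < card X"
      using tight AX fin by (metis card_gt_0_iff card_Diff_subset card_mono diff_less finA less_le_trans)
    \<comment> \<open>Hall's condition for \<open>A \<union> B\<close> gives this inequality,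
      because tightness leaves at most \<open>card A\<close> elements in \<open>?U\<close>.\<close>
    have "card B \<le> card (\<Union>x\<in>B. N x - ?U)" if B: "B \<subseteq> X - A" for B
    proof -
      have finB: "finite B" using B fin by (meson finite_Diff finite_subset)
      have "card A + card B = card (A \<union> B)"
        using B finA finB by (intro card_Un_disjoint[symmetric]) auto
      also have "\<dots> \<le> card (\<Union>x\<in>A \<union> B. N x)" using B AX by (intro hall) auto
      also have "(\<Union>x\<in>A \<union> B. N x) = ?U \<union> (\<Union>x\<in>B. N x - ?U)" by auto
      also have "card \<dots> \<le> card ?U + card (\<Union>x\<in>B. N x - ?U)" by (rule card_Un_le)
      finally show ?thesis using tight(3) by simp
    qed
    then obtain h where h: "inj_on h (X - A)" "\<forall>x\<in>X - A. h x \<in> N x - ?U"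
      using less.hyps[OF cX, of "\<lambda>x. N x - ?U"] fin finN by (metis DiffD1 finite_Diff)
    let ?k = "\<lambda>x. if x \<in> A then g x else h x"
    have "inj_on ?k X"
      unfolding inj_on_def using g h
      by (smt (verit) DiffD2 DiffI UN_I inj_onD)
    moreover have "\<forall>x\<in>X. ?k x \<in> N x" using g h by auto
    ultimately show ?thesis by (intro exI[of _ ?k]) blast
  next
    case spare
    then obtain x where x: "x \<in> X" by blast
    have "card {x} \<le> card (\<Union>y\<in>{x}. N y)" using x by (intro hall) auto
    then obtain z where z: "z \<in> N x" by fastforce
    have cX: "card (X - {x}) < card X" using x fin by (metis card_Diff1_less)
    \<comment> \<open>Deleting \<open>z\<close> costs at most one element, which the strict
      inequality of this case pays for.\<close>
    have "card B \<le> card (\<Union>y\<in>B. N y - {z})" if B: "B \<subseteq> X - {x}" for B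
    proof (cases "B = {}")
      case False
      have "card B < card (\<Union>y\<in>B. N y)" using B x False by (intro spare) auto
      also have "\<dots> \<le> card ((\<Union>y\<in>B. N y) - {z}) + 1"
        by (metis Suc_eq_plus1 card_Diff_singleton_if diff_Suc_1 le_Suc_eq le_diff_conv nat_le_linear)
      also have "(\<Union>y\<in>B. N y) - {z} = (\<Union>y\<in>B. N y - {z})" by auto
      finally show ?thesis by simp
    qed simp
    then obtain h where h: "inj_on h (X - {x})" "\<forall>y\<in>X - {x}. h y \<in> N y - {z}"
      using less.hyps[OF cX, of "\<lambda>y. N y - {z}"] fin finN by (metis DiffD1 finite_Diff)
    have "inj_on (h(x := z)) X"
      using h unfolding inj_on_def by (metis DiffD2 DiffI fun_upd_apply singletonD singletonI)
    then show ?thesis using h z by (intro exI[of _ "h(x := z)"]) auto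
  qed
qed

section \<open>Lines as annihilators of covectors\<close>

lemma columns_if_det_nonzero:
  fixes M :: "'a::field^'n^'n"
  assumes "det M \<noteq> 0"
  shows "inj (\<lambda>s. column s M)" and "vec.independent (columns M)"
proof -
  show "inj (\<lambda>s. column s M)"
    by (rule injI, rule ccontr) (use assms det_identical_columns[of _ _ M] in blast)
  show "vec.independent (columns M)"
    using assms det_dependent_rows[of "transpose M"] by (auto simp: rows_transpose)
qed

text \<open>The columns indexed by \<open>S\<close> are distinct and independent. With line vectors
  as columns this bounds the rank of a family of lines from below.\<close>

lemma card_le_dim_columns:
  fixes M :: "'a::field^'n^'n"
  assumes "det M \<noteq> 0" and "\<And>s. s \<in> S \<Longrightarrow> column s M \<in> V"
  shows "card S \<le> vec.dim V"
proof -
  have "card S = card ((\<lambda>s. column s M) ` S)"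
    using columns_if_det_nonzero(1)[OF assms(1)]
    by (intro card_image[symmetric]) (auto intro: inj_on_subset)
  moreover have "vec.independent ((\<lambda>s. column s M) ` S)"
    by (rule vec.independent_mono[OF columns_if_det_nonzero(2)[OF assms(1)]])
      (auto simp: columns_def)
  ultimately show ?thesis
    using vec.independent_card_le_dim[of "(\<lambda>s. column s M) ` S" V] assms(2) by auto
qed

lemma det_nonzero_if_trivial_kernel:
  fixes A :: "'a::field^'n^'n"
  assumes "\<And>v. A *v v = 0 \<Longrightarrow> v = 0"
  shows "det A \<noteq> 0"
proof -
  have "\<exists>B. B ** A = mat 1" using assms by (subst matrix_left_invertible_ker) blast
  then show ?thesis by (simp flip: invertible_det_nz add: invertible_left_inverse)
qed

lemma dim_inj_image:
  fixes A :: "'a::field^'n^'n"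
  assumes "det A \<noteq> 0"
  shows "vec.dim ((*v) A ` V) = vec.dim V"
proof -
  have "inj ((*v) A)"
    using assms invertible_det_nz invertible_left_inverse matrix_left_invertible_injective by blast
  then show ?thesis
    by (intro vec.dim_image_eq) (auto intro: inj_on_subset)
qed

section \<open>Covectors, annihilators and Cramer's rule\<close>

definition pairing :: "complex^'n \<Rightarrow> complex^'n \<Rightarrow> complex" where
  "pairing u v = (\<Sum>l\<in>UNIV. u $ l * v $ l)"

lemma pairing_axis [simp]: "pairing (axis r 1) v = v $ r"
  by (simp add: pairing_def axis_def if_distrib[of "\<lambda>z. z * _"] cong: if_cong)

text \<open>The exponent \<open>a\<close> need not be a point of \<open>T_points\<close>. For a
  point it yields the line of that point; for the lower corner of a simplex it yields a space
  containing all lines of the simplex.\<close>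

definition annihilator ::
    "('d \<Rightarrow> nat \<Rightarrow> complex^'n) \<Rightarrow> ('d \<Rightarrow> nat) \<Rightarrow> (complex^'n) set" where
  "annihilator f a = {v. \<forall>j. \<forall>i<a j. pairing (f j i) v = 0}"

lemma subspace_annihilator: "vec.subspace (annihilator f a)"
  unfolding vec.subspace_def annihilator_def pairing_def
  by (simp add: ring_distribs sum.distrib mult.left_commute flip: sum_distrib_left)

text \<open>The index set of the covectors that cut out \<open>annihilator f a\<close>.\<close>

definition cells :: "('d \<Rightarrow> nat) \<Rightarrow> ('d \<times> nat) set" where
  "cells a = {(j, i). i < a j}"

lemma finite_cells [simp]: "finite (cells (a :: 'd::finite \<Rightarrow> nat))"
  and card_cells: "card (cells a) = (\<Sum>j\<in>UNIV. a j)"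
proof -
  have "cells a = Sigma UNIV (\<lambda>j. {..<a j})" by (auto simp: cells_def)
  then show "finite (cells a)" "card (cells a) = (\<Sum>j\<in>UNIV. a j)"
    by (simp_all only: card_SigmaI finite_SigmaI finite finite_lessThan ball_simps card_lessThan simp_thms)
qed

text \<open>The rows are the covectors vanishing on the line of a point \<open>x\<close>, listed by \<open>\<beta>\<close>,
  except for one spare row \<open>r\<close>, which is the coordinate \<open>r\<close>.\<close>

definition row_matrix ::
    "('n \<Rightarrow> 'd \<times> nat) \<Rightarrow> 'n \<Rightarrow> ('d \<Rightarrow> nat \<Rightarrow> complex^'n) \<Rightarrow> complex^'n^'n" where
  "row_matrix \<beta> r f = (\<chi> i. if i = r then axis r 1 else f (fst (\<beta> i)) (snd (\<beta> i)))"

text \<open>The numerators in Cramer's rule for the system with matrix \<open>row_matrix \<beta> r f\<close> and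
  right-hand side \<open>axis r 1\<close>; they span the line and are polynomial in \<open>f\<close>.\<close>

definition line_vector ::
    "('n \<Rightarrow> 'd \<times> nat) \<Rightarrow> 'n \<Rightarrow> ('d \<Rightarrow> nat \<Rightarrow> complex^'n) \<Rightarrow> complex^'n" where
  "line_vector \<beta> r f =
     (\<chi> k. det (\<chi> i j. if j = k then axis r 1 $ i else row_matrix \<beta> r f $ i $ j))"

lemma row_matrix_mult:
  "(row_matrix \<beta> r f *v v) $ i =
     (if i = r then v $ r else pairing (f (fst (\<beta> i)) (snd (\<beta> i))) v)"
  using pairing_axis[of r v]
  by (simp add: row_matrix_def matrix_vector_mult_def pairing_def)

text \<open>Cramer's rule with the denominator cleared, so that the vector \<open>w\<close> is
  polynomial in the entries of \<open>A\<close> and \<open>b\<close>.\<close>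

lemma det_scaled_solution:
  fixes A :: "'a::field^'n^'n"
  assumes "det A \<noteq> 0" and "w = (\<chi> k. det (\<chi> i j. if j = k then b $ i else A $ i $ j))"
  shows "A *v w = det A *s b" and "A *v u = b \<Longrightarrow> w = det A *s u"
proof -
  have *: "A *v x = b \<longleftrightarrow> w = det A *s x" for x
    unfolding cramer[OF assms(1)] using assms by (auto simp: vec_eq_iff field_simps)
  have "A *v ((1 / det A) *s w) = b" using assms(1) by (subst *) (simp add: vec_eq_iff)
  then have "(1 / det A) *s (A *v w) = b" by (simp add: vector_scalar_commute)
  then show "A *v w = det A *s b" using assms(1) by (simp add: vec_eq_iff field_simps)
  show "A *v u = b \<Longrightarrow> w = det A *s u" using * by blast
qed

text \<open>The matrix sends the line vector to a nonzero multiple of \<open>axis r 1\<close>. The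
  rows other than \<open>r\<close> are exactly the covectors of \<open>x\<close>, so these vanish on
  it, and row \<open>r\<close> shows that it is nonzero.\<close>

lemma line_vector_in_annihilator:
  assumes "det (row_matrix \<beta> r f) \<noteq> 0" and "bij_betw \<beta> (UNIV - {r}) (cells x)"
  shows "line_vector \<beta> r f \<in> annihilator f x" and "line_vector \<beta> r f \<noteq> 0"
proof -
  let ?w = "line_vector \<beta> r f"
  have eq: "row_matrix \<beta> r f *v ?w = det (row_matrix \<beta> r f) *s axis r 1"
    using det_scaled_solution(1)[OF assms(1)] unfolding line_vector_def by blast
  show "?w \<in> annihilator f x"
    unfolding annihilator_def
  proof (intro CollectI allI impI)
    fix j i assume "i < x j"
    then have "(j, i) \<in> \<beta> ` (UNIV - {r})"
      using assms(2) by (auto simp: bij_betw_def cells_def)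
    then obtain s where s: "s \<noteq> r" "\<beta> s = (j, i)" by force
    then have "pairing (f j i) ?w = (row_matrix \<beta> r f *v ?w) $ s"
      by (simp add: row_matrix_mult)
    also have "\<dots> = 0" unfolding eq using s by (simp add: axis_def)
    finally show "pairing (f j i) ?w = 0" .
  qed
  have "(row_matrix \<beta> r f *v ?w) $ r \<noteq> 0"
    unfolding eq using assms(1) by (simp add: axis_def)
  then show "?w \<noteq> 0" by (auto simp: row_matrix_mult)
qed

text \<open>If the listed covectors have entry 0 at \<open>r\<close>, then \<open>axis r 1\<close>
  itself solves the linear system.\<close>

lemma line_vector_eq_axis:
  assumes "det (row_matrix \<beta> r f) \<noteq> 0"
    and "\<And>i. i \<noteq> r \<Longrightarrow> f (fst (\<beta> i)) (snd (\<beta> i)) $ r = 0"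
  shows "line_vector \<beta> r f = det (row_matrix \<beta> r f) *s axis r 1"
proof -
  have "row_matrix \<beta> r f *v axis r 1 = axis r 1"
    using assms(2)
    by (simp add: vec_eq_iff row_matrix_mult pairing_def axis_def
        if_distrib[of "\<lambda>z. _ * z"] cong: if_cong)
  then show ?thesis
    using det_scaled_solution(2)[OF assms(1)] unfolding line_vector_def by blast
qed

text \<open>The covectors of \<open>a\<close> are among the independent rows belonging to
  \<open>x\<close>. The invertible matrix therefore embeds the annihilator into the span of the
  coordinates outside these rows.\<close>

lemma dim_annihilator_le:
  fixes f :: "'d::finite \<Rightarrow> nat \<Rightarrow> complex^'n"
  assumes "det (row_matrix \<beta> r f) \<noteq> 0" and "bij_betw \<beta> (UNIV - {r}) (cells x)"
    and "\<And>j. a j \<le> x j"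
  shows "vec.dim (annihilator f a) \<le> CARD('n) - (\<Sum>j\<in>UNIV. a j)"
proof -
  define S where "S = {i. i \<noteq> r \<and> \<beta> i \<in> cells a}"
  let ?A = "row_matrix \<beta> r f"
  have "cells a \<subseteq> cells x" using assms(3) by (auto simp: cells_def intro: less_le_trans)
  moreover have "\<beta> ` S = \<beta> ` (UNIV - {r}) \<inter> cells a" by (auto simp: S_def)
  ultimately have "\<beta> ` S = cells a"
    using assms(2) by (simp add: bij_betw_def Int_absorb1)
  moreover have "inj_on \<beta> S"
    using assms(2) by (auto simp: S_def bij_betw_def intro: inj_on_subset)
  ultimately have "card S = (\<Sum>j\<in>UNIV. a j)"
    by (metis card_cells card_image)
  then have card: "card (- S) = CARD('n) - (\<Sum>j\<in>UNIV. a j)"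
    by (simp add: Compl_eq_Diff_UNIV card_Diff_subset)
  have "(*v) ?A ` annihilator f a \<subseteq> vec.span ((\<lambda>i. axis i 1) ` (- S))"
  proof safe
    fix v assume v: "v \<in> annihilator f a"
    have 0: "(?A *v v) $ i = 0" if "i \<in> S" for i
      using v that by (auto simp: S_def row_matrix_mult annihilator_def cells_def split_beta)
    have "?A *v v = (\<Sum>i\<in>UNIV. (?A *v v) $ i *s axis i 1)"
      by (rule basis_expansion[symmetric])
    also have "\<dots> = (\<Sum>i\<in>- S. (?A *v v) $ i *s axis i 1)"
      by (rule sum.mono_neutral_right) (auto simp: 0)
    also have "\<dots> \<in> vec.span ((\<lambda>i. axis i 1) ` (- S))"
      by (intro vec.span_sum vec.span_scale vec.span_base) auto
    finally show "?A *v v \<in> vec.span ((\<lambda>i. axis i 1) ` (- S))" .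
  qed
  then have "vec.dim ((*v) ?A ` annihilator f a) \<le> card ((\<lambda>i. axis i 1 :: complex^'n) ` (- S))"
    by (rule vec.dim_le_card) simp
  also have "\<dots> \<le> card (- S)" by (rule card_image_le) simp
  finally show ?thesis by (simp add: dim_inj_image[OF assms(1)] card)
qed

section \<open>Independent sets of lattice points and covectors adapted to them\<close>

lemma finite_T_points: "finite (T_points n :: ('d::finite \<Rightarrow> nat) set)"
proof (rule finite_subset)
  show "T_points n \<subseteq> (PiE UNIV (\<lambda>_. {..n}) :: ('d \<Rightarrow> nat) set)"
  proof safe
    fix x :: "'d \<Rightarrow> nat" and i assume "x \<in> T_points n"
    moreover have "x i \<le> (\<Sum>i\<in>UNIV. x i)" by (rule member_le_sum) auto
    ultimately show "x i \<le> n" by (auto simp: T_points_def)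
  qed simp
qed (simp add: finite_PiE)

text \<open>The simplex with lower corner \<open>a\<close> has size \<open>n\<close> minus the sum
  of \<open>a\<close>; the strict inequality makes this size at least 1, as the matroid condition
  demands.\<close>

lemma T_independent_card_le:
  assumes "I \<in> snd (T_matroid n)" and "J \<subseteq> I" and "\<And>x j. x \<in> J \<Longrightarrow> a j \<le> x j"
    and "(\<Sum>j\<in>UNIV. a j) < n"
  shows "card J \<le> n - (\<Sum>j\<in>UNIV. a j)"
proof -
  let ?k = "n - (\<Sum>j\<in>UNIV. a j)"
  let ?D = "{x \<in> T_points n. \<forall>j. a j \<le> x j}"
  have "I \<subseteq> T_points n" using assms(1) by (simp add: T_matroid_def)
  have "?D \<in> T_simplices n ?k"
    unfolding T_simplices_def using assms(4) by (intro CollectI exI[of _ a]) simp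
  then have "card (I \<inter> ?D) \<le> ?k"
    using assms(1,4) unfolding T_matroid_def by fastforce
  moreover have "card J \<le> card (I \<inter> ?D)"
    using assms(2,3) \<open>I \<subseteq> T_points n\<close> finite_T_points[of n]
    by (intro card_mono) (auto intro: finite_subset)
  ultimately show ?thesis by simp
qed

definition masked ::
    "(('d \<Rightarrow> nat) \<Rightarrow> 'n) \<Rightarrow> ('d \<Rightarrow> nat) set \<Rightarrow> ('d \<Rightarrow> nat \<Rightarrow> complex^'n) \<Rightarrow> 'd \<Rightarrow> nat \<Rightarrow> complex^'n"
  where "masked \<sigma> I c j i = (\<chi> s. if \<exists>y\<in>I. \<sigma> y = s \<and> i < y j then 0 else c j i $ s)"

text \<open>The covectors are given the zeros that put the line of each \<open>x \<in> I\<close> onto the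
  coordinate axis \<open>\<sigma> x\<close>; Hall's condition is the defining inequality of the matroid
  for the smallest simplex containing \<open>x\<close> and a given set of further points.\<close>

lemma masked_row_matrix_nonsingular:
  fixes I :: "('d::finite \<Rightarrow> nat) set" and \<sigma> :: "_ \<Rightarrow> 'n::finite"
  assumes I: "I \<in> snd (T_matroid CARD('n))" and \<sigma>: "inj_on \<sigma> I" and x: "x \<in> I"
    and \<beta>: "bij_betw \<beta> (UNIV - {\<sigma> x}) (cells x)"
  shows "\<exists>c. det (row_matrix \<beta> (\<sigma> x) (masked \<sigma> I c)) \<noteq> 0"
proof -
  define r where "r = \<sigma> x"
  \<comment> \<open>\<open>N s\<close> consists of the cells of \<open>x\<close> whose covector
    keeps a free entry at coordinate \<open>s\<close> after masking.\<close>
  define N where "N s = {(j, i) \<in> cells x. \<forall>y\<in>I. \<sigma> y = s \<longrightarrow> y j \<le> i}" for s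
  have IT: "I \<subseteq> T_points CARD('n)" using I by (simp add: T_matroid_def)
  have finI: "finite I" using IT finite_T_points by (rule finite_subset)
  have cx: "card (cells x) = CARD('n) - 1"
    using x IT by (auto simp: card_cells T_points_def)
  have finN: "finite (N s)" for s by (rule finite_subset[of _ "cells x"]) (auto simp: N_def)
  have hall: "card A \<le> card (\<Union>s\<in>A. N s)" if A: "A \<subseteq> UNIV - {r}" for A
  proof (cases "A \<subseteq> \<sigma> ` I")
    case False
    then obtain s where "s \<in> A" "N s = cells x" by (force simp: N_def)
    then have "card (cells x) \<le> card (\<Union>s\<in>A. N s)"
      by (intro card_mono) (auto intro: finN)
    moreover have "card A \<le> card (UNIV - {r})" using A by (intro card_mono) auto
    ultimately show ?thesis by (simp add: cx)
  next
    case True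
    then obtain J where J: "J \<subseteq> I" "A = \<sigma> ` J" by (meson subset_image_iff)
    have xJ: "x \<notin> J" using J A by (auto simp: r_def)
    have finJ: "finite J" using J finI finite_subset by blast
    \<comment> \<open>The componentwise minimum is the lower corner of the smallest simplex
      containing \<open>x\<close> and \<open>J\<close>.\<close>
    define a where "a j = Min ((\<lambda>y. y j) ` insert x J)" for j
    have a_le: "a j \<le> y j" if "y \<in> insert x J" for j y
      unfolding a_def using that finJ by (intro Min_le) auto
    have sum_x: "(\<Sum>j\<in>UNIV. x j) + 1 = CARD('n)" using x IT by (auto simp: T_points_def)
    have sum_a: "(\<Sum>j\<in>UNIV. a j) \<le> (\<Sum>j\<in>UNIV. x j)" by (intro sum_mono a_le) simp
    \<comment> \<open>Counting \<open>x\<close> along with \<open>J\<close> compensates for the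
      coordinate sum of \<open>x\<close> being \<open>n - 1\<close> rather than
      \<open>n\<close>.\<close>
    have "card (insert x J) \<le> CARD('n) - (\<Sum>j\<in>UNIV. a j)"
      using sum_x sum_a J x by (intro T_independent_card_le[OF I]) (auto intro: a_le)
    then have "card J \<le> (\<Sum>j\<in>UNIV. x j) - (\<Sum>j\<in>UNIV. a j)"
      using xJ finJ sum_x sum_a by simp
    also have "\<dots> = card (cells x) - card (cells a)" by (simp add: card_cells)
    also have "\<dots> = card (cells x - cells a)"
    proof (rule card_Diff_subset[symmetric])
      show "cells a \<subseteq> cells x" using a_le by (auto simp: cells_def intro: less_le_trans)
    qed simp
    also have "\<dots> \<le> card (\<Union>s\<in>A. N s)"
    proof (intro card_mono)
      show "finite (\<Union>s\<in>A. N s)" by (auto intro: finN)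
      \<comment> \<open>For such a cell \<open>(j, i)\<close> the minimum \<open>a j\<close> is at
        most \<open>i\<close>, hence below \<open>x j\<close>. It is attained at some
        \<open>y\<close> in \<open>J\<close>, and injectivity of \<open>\<sigma>\<close> makes
        \<open>y\<close> the only point that could mask coordinate
        \<open>\<sigma> y\<close>.\<close>
      show "cells x - cells a \<subseteq> (\<Union>s\<in>A. N s)"
      proof safe
        fix j i assume *: "(j, i) \<in> cells x" "(j, i) \<notin> cells a"
        have "a j \<in> (\<lambda>y. y j) ` insert x J"
          unfolding a_def using finJ by (intro Min_in) auto
        then obtain y where y: "y \<in> insert x J" "a j = y j" by blast
        then have "y \<in> J" using * by (auto simp: cells_def)
        moreover have "(j, i) \<in> N (\<sigma> y)"
          using * y \<open>y \<in> J\<close> J(1) \<sigma> by (auto simp: N_def cells_def dest: inj_onD)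
        ultimately show "(j, i) \<in> (\<Union>s\<in>A. N s)" using J by blast
      qed
    qed
    also have "card J = card A" using J \<sigma> by (metis card_image inj_on_subset)
    finally show ?thesis .
  qed
  obtain h where h: "inj_on h (UNIV - {r})" "\<forall>s\<in>UNIV - {r}. h s \<in> N s"
    using hall_marriage[of "UNIV - {r}" N] finN hall by auto
  \<comment> \<open>The 0/1 tuple of the matching: after masking, the covector at cell
    \<open>h s\<close> is \<open>axis s 1\<close>. Up to the order of its rows, the matrix becomes
    the identity.\<close>
  define c :: "'d \<Rightarrow> nat \<Rightarrow> complex^'n"
    where "c j i = (\<chi> s. if s \<noteq> r \<and> h s = (j, i) then 1 else 0)" for j i
  have "v = 0" if v: "row_matrix \<beta> r (masked \<sigma> I c) *v v = 0" for v
  proof -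
    have "v $ s = 0" for s
    proof (cases "s = r")
      case True
      then show ?thesis using v row_matrix_mult[of \<beta> r _ v r] by (metis zero_index)
    next
      case False
      obtain j i where ji: "h s = (j, i)" by fastforce
      have hs: "(j, i) \<in> N s" using h(2) False ji by (metis DiffI UNIV_I singletonD)
      then have "(j, i) \<in> \<beta> ` (UNIV - {r})"
        using \<beta> by (auto simp: N_def bij_betw_def r_def)
      then obtain k where k: "k \<noteq> r" "\<beta> k = (j, i)" by force
      have "masked \<sigma> I c j i $ t = axis s 1 $ t" for t
      proof (cases "t = s")
        case True
        then show ?thesis using hs False ji
          by (auto simp: masked_def c_def axis_def N_def not_less)
      next
        case t: False
        have "\<not> (t \<noteq> r \<and> h t = (j, i))"
          using inj_onD[OF h(1), of t s] t False ji by auto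
        then show ?thesis using t by (auto simp: masked_def c_def axis_def)
      qed
      then have "masked \<sigma> I c j i = axis s 1" by (simp add: vec_eq_iff)
      then have "(row_matrix \<beta> r (masked \<sigma> I c) *v v) $ k = v $ s"
        using k by (simp add: row_matrix_mult)
      then show ?thesis using v by simp
    qed
    then show ?thesis by (simp add: vec_eq_iff)
  qed
  then have "det (row_matrix \<beta> r (masked \<sigma> I c)) \<noteq> 0"
    by (rule det_nonzero_if_trivial_kernel)
  then show ?thesis by (auto simp: r_def)
qed

text \<open>The substitution \<open>g\<close> covers both the plain covectors and the masked ones.
  The bound on \<open>x\<close> keeps every index used in the range allowed by
  \<open>entry\<close>.\<close>

lemma polynomial_in_entries_row_matrix:
  fixes g :: "('e \<Rightarrow> nat \<Rightarrow> complex^'n) \<Rightarrow> 'd \<Rightarrow> nat \<Rightarrow> complex^'n"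
  assumes "bij_betw \<beta> (UNIV - {r}) (cells x)" and "\<And>j. x j \<le> CARD('n)"
    and "\<And>j i l. i < CARD('n) \<Longrightarrow> polynomial_in_entries (\<lambda>f. g f j i $ l)"
  shows "polynomial_in_entries (\<lambda>f. row_matrix \<beta> r (g f) $ i $ k)"
proof (cases "i = r")
  case True
  then show ?thesis by (simp add: row_matrix_def polynomial_in_entries.const)
next
  case False
  then have "\<beta> i \<in> cells x" using assms(1) by (auto simp: bij_betw_def)
  then have "snd (\<beta> i) < CARD('n)"
    using assms(2) by (auto simp: cells_def intro: less_le_trans)
  then show ?thesis using False by (simp add: row_matrix_def assms(3))
qed

text \<open>Two kinds of determinants suffice. The row matrices give nonzero lines and the dimension
  bounds; a matrix \<open>M f\<close> with the line vectors as columns gives the rank of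
  \<open>I\<close>. One masked tuple \<open>f0\<close> makes all of them nonzero.\<close>

lemma generic_covectors:
  fixes I :: "('d::finite \<Rightarrow> nat) set"
  assumes I: "I \<in> snd (T_matroid CARD('n::finite))"
  shows "generic_tuple (\<lambda>f :: 'd \<Rightarrow> nat \<Rightarrow> complex^'n.
    card I \<le> vec.dim (\<Union>x\<in>I. annihilator f x) \<and>
    (\<forall>x\<in>I. annihilator f x \<noteq> {0} \<and>
       (\<forall>a. (\<forall>j. a j \<le> x j) \<longrightarrow> vec.dim (annihilator f a) \<le> CARD('n) - (\<Sum>j\<in>UNIV. a j))))"
proof -
  have IT: "I \<subseteq> T_points CARD('n)" using I by (simp add: T_matroid_def)
  have finI: "finite I" using IT finite_T_points by (rule finite_subset)
  \<comment> \<open>The corner 0 gives the whole of \<open>T_points\<close>, a simplex of size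
    \<open>n\<close>, so there are enough coordinates for the points of \<open>I\<close>.\<close>
  have "card I \<le> CARD('n) - (\<Sum>j\<in>(UNIV::'d set). 0)"
    by (rule T_independent_card_le[OF I]) auto
  then obtain \<sigma> :: "('d \<Rightarrow> nat) \<Rightarrow> 'n" where \<sigma>: "inj_on \<sigma> I"
    using card_le_inj[of I "UNIV :: 'n set"] finI by auto
  have "\<exists>\<beta>. bij_betw \<beta> (UNIV - {\<sigma> x}) (cells x)" if "x \<in> I" for x
  proof (rule finite_same_card_bij)
    show "card (UNIV - {\<sigma> x}) = card (cells x)"
      using that IT by (auto simp: card_cells T_points_def)
  qed auto
  then obtain \<beta> where \<beta>: "\<And>x. x \<in> I \<Longrightarrow> bij_betw (\<beta> x) (UNIV - {\<sigma> x}) (cells x)"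
    by metis
  have x_le: "x j \<le> CARD('n)" if "x \<in> I" for x j
  proof -
    have "x j \<le> (\<Sum>j\<in>UNIV. x j)" by (rule member_le_sum) auto
    then show ?thesis using that IT by (auto simp: T_points_def)
  qed
  have poly_rows: "polynomial_in_entries (\<lambda>f. row_matrix (\<beta> x) (\<sigma> x) f $ i $ k)" if "x \<in> I" for x i k
    using polynomial_in_entries_row_matrix[OF \<beta>[OF that], of "\<lambda>f. f"] x_le[OF that]
    by (auto intro: polynomial_in_entries.entry)

  \<comment> \<open>The matching tuple depends on \<open>x\<close>. Since masking is polynomial in
    \<open>c\<close>, genericity supplies one \<open>c\<close> for all \<open>x\<close> at
    once.\<close>
  have "generic_tuple (\<lambda>c. \<forall>x\<in>I. det (row_matrix (\<beta> x) (\<sigma> x) (masked \<sigma> I c)) \<noteq> 0)"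
  proof (intro generic_tuple_ball finI)
    fix x assume x: "x \<in> I"
    have "polynomial_in_entries (\<lambda>f. masked \<sigma> I f j i $ l)" if "i < CARD('n)" for i j l
      using that by (cases "\<exists>y\<in>I. \<sigma> y = l \<and> i < y j")
        (simp_all only: masked_def vec_lambda_beta if_True if_False
          polynomial_in_entries.const polynomial_in_entries.entry)
    then have "polynomial_in_entries (\<lambda>c. row_matrix (\<beta> x) (\<sigma> x) (masked \<sigma> I c) $ i $ k)" for i k
      using polynomial_in_entries_row_matrix[OF \<beta>[OF x], of "masked \<sigma> I"] x_le[OF x] by blast
    moreover obtain c where "det (row_matrix (\<beta> x) (\<sigma> x) (masked \<sigma> I c)) \<noteq> 0"
      using masked_row_matrix_nonsingular[OF I \<sigma> x \<beta>[OF x]] by blast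
    ultimately show "generic_tuple (\<lambda>c. det (row_matrix (\<beta> x) (\<sigma> x) (masked \<sigma> I c)) \<noteq> 0)"
      by (rule generic_tuple_det[of "\<lambda>c. row_matrix (\<beta> x) (\<sigma> x) (masked \<sigma> I c)"])
  qed
  then obtain c where c: "\<And>x. x \<in> I \<Longrightarrow> det (row_matrix (\<beta> x) (\<sigma> x) (masked \<sigma> I c)) \<noteq> 0"
    unfolding generic_tuple_def by blast
  define f0 where "f0 = masked \<sigma> I c"
  have det_f0: "det (row_matrix (\<beta> x) (\<sigma> x) f0) \<noteq> 0" if "x \<in> I" for x
    using c[OF that] by (simp add: f0_def)

  define \<tau> where "\<tau> = inv_into I \<sigma>"
  define M where "M f = (\<chi> i s. if s \<in> \<sigma> ` I then line_vector (\<beta> (\<tau> s)) s f $ i else axis s 1 $ i)"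
    for f :: "'d \<Rightarrow> nat \<Rightarrow> complex^'n"
  have \<tau>: "\<tau> (\<sigma> x) = x" if "x \<in> I" for x
    using that \<sigma> by (simp add: \<tau>_def)
  have poly_M: "polynomial_in_entries (\<lambda>f. M f $ i $ s)" for i s
  proof (cases "s \<in> \<sigma> ` I")
    case True
    then obtain x where x: "x \<in> I" "s = \<sigma> x" by blast
    let ?C = "\<lambda>f. (\<chi> p q. if q = i then axis (\<sigma> x) 1 $ p
        else row_matrix (\<beta> x) (\<sigma> x) f $ p $ q)"
    have "polynomial_in_entries (\<lambda>f. ?C f $ p $ q)" for p q
      using x by (cases "q = i") (simp_all add: polynomial_in_entries.const poly_rows)
    then have "polynomial_in_entries (\<lambda>f. det (?C f))"
      by (rule polynomial_in_entries_det[of ?C])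
    then show ?thesis using x \<tau> by (simp add: M_def line_vector_def)
  next
    case False
    then show ?thesis by (simp add: M_def polynomial_in_entries.const)
  qed
  have "det (M f0) \<noteq> 0"
  proof -
    have eq: "line_vector (\<beta> x) (\<sigma> x) f0 = det (row_matrix (\<beta> x) (\<sigma> x) f0) *s axis (\<sigma> x) 1"
      if x: "x \<in> I" for x
    proof (rule line_vector_eq_axis)
      show "det (row_matrix (\<beta> x) (\<sigma> x) f0) \<noteq> 0" using x by (rule det_f0)
      fix i assume "i \<noteq> \<sigma> x"
      then have "\<beta> x i \<in> cells x" using \<beta>[OF x] by (auto simp: bij_betw_def)
      then show "f0 (fst (\<beta> x i)) (snd (\<beta> x i)) $ \<sigma> x = 0"
        using x by (auto simp: f0_def masked_def cells_def)
    qed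
    \<comment> \<open>At \<open>f0\<close> every line vector is a multiple of its own coordinate
      axis, so the matrix is diagonal.\<close>
    have "M f0 $ i $ s = 0" if "i \<noteq> s" for i s
      using that \<tau> by (auto simp: M_def eq axis_def)
    then have "det (M f0) = (\<Prod>i\<in>UNIV. M f0 $ i $ i)" by (rule det_diagonal)
    moreover have "M f0 $ i $ i \<noteq> 0" for i
      using \<tau> det_f0 by (auto simp: M_def eq axis_def)
    ultimately show ?thesis by simp
  qed
  then have "generic_tuple (\<lambda>f. det (M f) \<noteq> 0)"
    by (rule generic_tuple_det[OF poly_M])
  moreover have "generic_tuple (\<lambda>f. \<forall>x\<in>I. det (row_matrix (\<beta> x) (\<sigma> x) f) \<noteq> 0)"
  proof (intro generic_tuple_ball finI)
    fix x assume x: "x \<in> I"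
    show "generic_tuple (\<lambda>f. det (row_matrix (\<beta> x) (\<sigma> x) f) \<noteq> 0)"
      using poly_rows[OF x] det_f0[OF x] by (rule generic_tuple_det)
  qed
  ultimately have "generic_tuple (\<lambda>f. det (M f) \<noteq> 0 \<and>
      (\<forall>x\<in>I. det (row_matrix (\<beta> x) (\<sigma> x) f) \<noteq> 0))"
    by (rule generic_tuple_conj)
  then show ?thesis
  proof (rule generic_tuple_mono, intro conjI ballI allI impI)
    fix f assume f: "det (M f) \<noteq> 0 \<and> (\<forall>x\<in>I. det (row_matrix (\<beta> x) (\<sigma> x) f) \<noteq> 0)"
    have mem: "line_vector (\<beta> x) (\<sigma> x) f \<in> annihilator f x \<and> line_vector (\<beta> x) (\<sigma> x) f \<noteq> 0"
      if "x \<in> I" for x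
      using line_vector_in_annihilator[OF _ \<beta>[OF that]] f that by blast
    have "column (\<sigma> x) (M f) \<in> annihilator f x" if "x \<in> I" for x
    proof -
      have "column (\<sigma> x) (M f) = line_vector (\<beta> x) (\<sigma> x) f"
        using that \<tau> by (simp add: column_def M_def)
      then show ?thesis using mem that by simp
    qed
    then have "card (\<sigma> ` I) \<le> vec.dim (\<Union>x\<in>I. annihilator f x)"
      using f by (intro card_le_dim_columns[of "M f"]) auto
    then show "card I \<le> vec.dim (\<Union>x\<in>I. annihilator f x)"
      by (simp add: card_image \<sigma>)
    show "annihilator f x \<noteq> {0}" if "x \<in> I" for x using mem[OF that] by auto
    show "vec.dim (annihilator f a) \<le> CARD('n) - (\<Sum>j\<in>UNIV. a j)"
      if "x \<in> I" "\<forall>j. a j \<le> x j" for x a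
      using dim_annihilator_le[OF _ \<beta>[OF that(1)]] f that by blast
  qed
qed

section \<open>Matroids of lines\<close>

lemma line_subset_span:
  fixes l :: "(complex^'n) set"
  assumes "vec.dim l = 1" and "v \<in> l" "v \<noteq> 0"
  shows "l \<subseteq> vec.span {v}"
  using assms by (intro vec.card_ge_dim_independent) auto

text \<open>A nonzero vector of a rank-one set spans it, so the span is the same for every choice of
  representatives.\<close>

lemma span_line_choice:
  fixes L :: "(complex^'n) set set"
  assumes "\<And>l. l \<in> L \<Longrightarrow> vec.dim l = 1" and "\<And>l. l \<in> L \<Longrightarrow> v l \<in> l \<and> v l \<noteq> 0"
  shows "vec.span (v ` L) = vec.span (\<Union>L)"
proof
  show "vec.span (v ` L) \<subseteq> vec.span (\<Union>L)" using assms(2) by (intro vec.span_mono) auto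
  have "l \<subseteq> vec.span (v ` L)" if "l \<in> L" for l
    using line_subset_span[of l "v l"] assms that vec.span_mono[of "{v l}" "v ` L"] by blast
  then show "vec.span (\<Union>L) \<subseteq> vec.span (v ` L)"
    by (intro vec.span_minimal vec.subspace_span) auto
qed

lemma ex_line_choice:
  fixes L :: "(complex^'n) set set"
  assumes "\<And>l. l \<in> L \<Longrightarrow> vec.dim l = 1"
  shows "\<exists>v. \<forall>l\<in>L. v l \<in> l \<and> v l \<noteq> 0"
proof (rule bchoice, rule ballI)
  fix l assume "l \<in> L"
  then have "\<not> l \<subseteq> {0}" using assms by (metis vec.dim_eq_0 zero_neq_one)
  then show "\<exists>y. y \<in> l \<and> y \<noteq> 0" by blast
qed

lemma independent_lines_iff_dim:
  fixes L :: "(complex^'n) set set"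
  assumes "finite L" and "\<And>l. l \<in> L \<Longrightarrow> vec.dim l = 1"
  shows "independent_lines L \<longleftrightarrow> vec.dim (\<Union>L) = card L"
proof
  obtain v where v: "\<forall>l\<in>L. v l \<in> l \<and> v l \<noteq> 0" using ex_line_choice assms(2) by blast
  assume "independent_lines L"
  then have "inj_on v L" "vec.independent (v ` L)" using v unfolding independent_lines_def by auto
  moreover have "vec.dim (\<Union>L) = vec.dim (v ` L)"
    using span_line_choice[of L v] assms(2) v by (metis vec.dim_span)
  ultimately show "vec.dim (\<Union>L) = card L"
    by (simp add: vec.dim_eq_card_independent card_image)
next
  assume dim: "vec.dim (\<Union>L) = card L"
  show "independent_lines L"
    unfolding independent_lines_def
  proof (intro allI impI)
    fix v assume v: "\<forall>l\<in>L. v l \<in> l \<and> v l \<noteq> 0"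
    have "vec.dim (v ` L) = card L"
      using span_line_choice[of L v] assms(2) v dim by (metis vec.dim_span)
    moreover have "vec.dim (v ` L) \<le> card (v ` L)"
      by (rule vec.dim_le_card) (use assms(1) in \<open>auto intro: vec.span_base\<close>)
    moreover have "card (v ` L) \<le> card L" using assms(1) by (rule card_image_le)
    ultimately have "card (v ` L) = card L" "card (v ` L) \<le> vec.dim (v ` L)" by simp_all
    moreover have "vec.independent (v ` L)"
      by (rule vec.card_le_dim_spanning[of _ "v ` L"])
        (use assms(1) calculation in \<open>auto intro: vec.span_base\<close>)
    ultimately show "inj_on v L \<and> vec.independent (v ` L)"
      using assms(1) by (simp add: inj_on_iff_eq_card)
  qed
qed

lemma dim_Union_lines_le:
  fixes L :: "(complex^'n) set set"
  assumes "finite L" and "\<And>l. l \<in> L \<Longrightarrow> vec.dim l = 1"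
  shows "vec.dim (\<Union>L) \<le> card L"
proof -
  obtain v where v: "\<forall>l\<in>L. v l \<in> l \<and> v l \<noteq> 0" using ex_line_choice assms(2) by blast
  have "vec.dim (\<Union>L) = vec.dim (v ` L)"
    using span_line_choice[of L v] assms(2) v by (metis vec.dim_span)
  also have "\<dots> \<le> card (v ` L)"
    by (rule vec.dim_le_card) (use assms(1) in \<open>auto intro: vec.span_base\<close>)
  also have "\<dots> \<le> card L" using assms(1) by (rule card_image_le)
  finally show ?thesis .
qed

text \<open>By the rank criterion, a single choice of representatives decides independence.\<close>

lemma independent_lines_iff_choice:
  fixes L :: "(complex^'n) set set"
  assumes "finite L" and "\<And>l. l \<in> L \<Longrightarrow> vec.dim l = 1" and "\<And>l. l \<in> L \<Longrightarrow> v l \<in> l \<and> v l \<noteq> 0"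
  shows "independent_lines L \<longleftrightarrow> inj_on v L \<and> vec.independent (v ` L)"
proof
  assume "inj_on v L \<and> vec.independent (v ` L)"
  moreover have "vec.dim (\<Union>L) = vec.dim (v ` L)"
    using span_line_choice[of L v] assms(2,3) by (metis vec.dim_span)
  ultimately show "independent_lines L"
    using assms by (simp add: independent_lines_iff_dim vec.dim_eq_card_independent card_image)
qed (use assms(3) in \<open>auto simp: independent_lines_def\<close>)

lemma independent_lines_subset:
  fixes L :: "(complex^'n) set set"
  assumes "independent_lines L" "K \<subseteq> L" "finite L" and "\<And>l. l \<in> L \<Longrightarrow> vec.dim l = 1"
  shows "independent_lines K"
proof -
  obtain v where v: "\<forall>l\<in>L. v l \<in> l \<and> v l \<noteq> 0" using ex_line_choice assms(4) by blast
  then have "inj_on v L \<and> vec.independent (v ` L)"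
    using assms(1) by (simp add: independent_lines_def)
  then have "inj_on v K \<and> vec.independent (v ` K)"
    using assms(2) by (meson image_mono inj_on_subset vec.independent_mono)
  then show ?thesis
    using assms v by (subst independent_lines_iff_choice[of _ v]) (auto intro: finite_subset)
qed

text \<open>With one choice of vectors fixed, exchange is Steinitz's: the larger independent set
  cannot lie in the span of the smaller one.\<close>

lemma matroid_line_matroid:
  fixes S :: "(complex^'n) set set"
  assumes "finite S" and dim1: "\<And>l. l \<in> S \<Longrightarrow> vec.dim l = 1"
  shows "matroid (line_matroid S)"
proof -
  have "\<exists>y\<in>Y - X. y \<in> S \<and> independent_lines (insert y X)"
    if XY: "X \<subseteq> S" "Y \<subseteq> S" "independent_lines X" "independent_lines Y" "card X < card Y" for X Y
  proof -
    have fin: "finite X" "finite Y" using XY assms(1) finite_subset by auto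
    obtain v where v: "\<forall>l\<in>S. v l \<in> l \<and> v l \<noteq> 0" using ex_line_choice dim1 by blast
    have vX: "inj_on v X" "vec.independent (v ` X)" and vY: "inj_on v Y" "vec.independent (v ` Y)"
      using XY v unfolding independent_lines_def by blast+
    have "\<not> v ` Y \<subseteq> vec.span (v ` X)"
    proof
      assume "v ` Y \<subseteq> vec.span (v ` X)"
      then have "card (v ` Y) \<le> card (v ` X)"
        using vec.independent_span_bound[of "v ` X" "v ` Y"] vY fin by auto
      then show False using XY(5) vX vY by (simp add: card_image)
    qed
    then obtain y where y: "y \<in> Y" "v y \<notin> vec.span (v ` X)" by blast
    then have "v y \<notin> v ` X" using vec.span_base by blast
    then have "y \<in> Y - X" using y by blast
    moreover have "independent_lines (insert y X)"
    proof (subst independent_lines_iff_choice[of _ v])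
      show "inj_on v (insert y X) \<and> vec.independent (v ` insert y X)"
        using vec.independent_insertI[OF y(2) vX(2)] vX(1) \<open>v y \<notin> v ` X\<close> by auto
    qed (use fin XY y v dim1 in auto)
    ultimately show ?thesis using XY(2) by blast
  qed
  moreover have "independent_lines ({} :: (complex^'n) set set)"
    by (simp add: independent_lines_def vec.independent_empty)
  moreover have "independent_lines K" if "independent_lines L" "K \<subseteq> L" "L \<subseteq> S" for K L
    using that assms by (meson independent_lines_subset finite_subset subsetD)
  ultimately show ?thesis
    unfolding matroid_def line_matroid_def using assms(1) by auto
qed

section \<open>From lines to lattice points\<close>

text \<open>Serves to prove the matroid axioms for \<open>T_matroid\<close>: they are pulled back
  from linear independence along the map from points to lines.\<close>

lemma matroid_transport:
  assumes "matroid (S, \<J>)" and g: "bij_betw g T S" and "\<I> \<subseteq> Pow T"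
    and iff: "\<And>X. X \<subseteq> T \<Longrightarrow> X \<in> \<I> \<longleftrightarrow> g ` X \<in> \<J>"
  shows "matroid (T, \<I>)"
proof -
  have S: "finite S" "{} \<in> \<J>"
    and down: "\<And>X Y. X \<in> \<J> \<Longrightarrow> Y \<subseteq> X \<Longrightarrow> Y \<in> \<J>"
    and exch: "\<And>X Y. X \<in> \<J> \<Longrightarrow> Y \<in> \<J> \<Longrightarrow> card X < card Y \<Longrightarrow> \<exists>y\<in>Y - X. insert y X \<in> \<J>"
    using assms(1) unfolding matroid_def by blast+
  have inj: "inj_on g T" using g by (simp add: bij_betw_def)
  have "finite T" using g S bij_betw_finite by blast
  moreover have "{} \<in> \<I>" using iff[of "{}"] S by simp
  moreover have "Y \<in> \<I>" if "X \<in> \<I>" "Y \<subseteq> X" for X Y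
    using that assms(3) iff down by (meson PowD image_mono subset_iff subset_trans)
  moreover have "\<exists>y\<in>Y - X. insert y X \<in> \<I>"
    if XY: "X \<in> \<I>" "Y \<in> \<I>" "card X < card Y" for X Y
  proof -
    have XT: "X \<subseteq> T" "Y \<subseteq> T" using XY assms(3) by auto
    have "card (g ` X) < card (g ` Y)"
      using XY XT inj by (metis card_image inj_on_subset)
    then obtain z where "z \<in> g ` Y - g ` X" "insert z (g ` X) \<in> \<J>"
      using exch[of "g ` X" "g ` Y"] XY(1,2) iff[OF XT(1)] iff[OF XT(2)] by auto
    then obtain y where "y \<in> Y - X" "g ` insert y X \<in> \<J>" by auto
    then show ?thesis using iff[of "insert y X"] XT by blast
  qed
  ultimately show ?thesis unfolding matroid_def using assms(3) by auto
qed

lemma T_independent_singleton: "x \<in> T_points n \<Longrightarrow> {x} \<in> snd (T_matroid n)"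
  by (auto simp: T_matroid_def card_insert_if Int_insert_left)

text \<open>A simplex of size 1 contains only its corner, and larger sizes allow two points anyway.
  This is what makes distinct points have distinct lines.\<close>

lemma T_independent_doubleton:
  assumes "x \<in> T_points n" "y \<in> T_points n"
  shows "{x, y} \<in> snd (T_matroid n)"
proof -
  have "card ({x, y} \<inter> D) \<le> k" if k: "1 \<le> k" and D: "D \<in> T_simplices n k" for k D
  proof (cases "k = 1")
    case True
    then obtain a where a: "D = {z \<in> T_points n. \<forall>j. a j \<le> z j}" "(\<Sum>j\<in>UNIV. a j) + 1 = n"
      using D by (auto simp: T_simplices_def)
    have "z = a" if "z \<in> D" for z
    proof (rule ccontr)
      assume "z \<noteq> a"
      then obtain j where "z j \<noteq> a j" by (auto simp: fun_eq_iff)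
      moreover have "a j \<le> z j" using \<open>z \<in> D\<close> a(1) by simp
      ultimately have "a j < z j" by simp
      then have "(\<Sum>j\<in>UNIV. a j) < (\<Sum>j\<in>UNIV. z j)"
        using \<open>z \<in> D\<close> a(1) by (intro sum_strict_mono_ex1) auto
      then show False using \<open>z \<in> D\<close> a by (simp add: T_points_def)
    qed
    then have "card ({x, y} \<inter> D) \<le> card {a}" by (intro card_mono) auto
    then show ?thesis using True by simp
  next
    case False
    have "card ({x, y} \<inter> D) \<le> card {x, y}" by (intro card_mono) auto
    also have "\<dots> \<le> 2" by (simp add: card_insert_if)
    finally show ?thesis using False k by simp
  qed
  then show ?thesis using assms by (auto simp: T_matroid_def)
qed

text \<open>The bound \<open>ge\<close> makes the lines of an independent set independent;
  \<open>le\<close>, applied to the corner of a violated simplex, makes the lines of a dependent set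
  dependent.\<close>

lemma line_matroid_T_matroid:
  fixes line :: "('d::finite \<Rightarrow> nat) \<Rightarrow> (complex^'n) set"
  assumes dim1: "\<And>x. x \<in> T_points n \<Longrightarrow> vec.dim (line x) = 1"
    and ge: "\<And>I. I \<in> snd (T_matroid n) \<Longrightarrow> card I \<le> vec.dim (\<Union>x\<in>I. line x)"
    and le: "\<And>I a. I \<subseteq> T_points n \<Longrightarrow> I \<noteq> {} \<Longrightarrow> (\<And>x j. x \<in> I \<Longrightarrow> a j \<le> x j) \<Longrightarrow>
      vec.dim (\<Union>x\<in>I. line x) \<le> n - (\<Sum>j\<in>UNIV. a j)"
  shows "inj_on line (T_points n)"
    and "matroid_isomorphism (inv_into (T_points n) line) (line_matroid (line ` T_points n)) (T_matroid n)"
proof -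
  let ?T = "T_points n :: ('d \<Rightarrow> nat) set"
  show inj: "inj_on line ?T"
  proof (rule inj_onI, rule ccontr)
    fix x y assume xy: "x \<in> ?T" "y \<in> ?T" "line x = line y" "x \<noteq> y"
    then have "card {x, y} \<le> vec.dim (\<Union>x\<in>{x, y}. line x)"
      by (intro ge T_independent_doubleton)
    then show False using xy dim1 by simp
  qed
  have iff: "I \<in> snd (T_matroid n) \<longleftrightarrow> independent_lines (line ` I)" if I: "I \<subseteq> ?T" for I
  proof
    have fin: "finite I" using I finite_T_points by (rule finite_subset)
    have dimI: "l \<in> line ` I \<Longrightarrow> vec.dim l = 1" for l using I dim1 by auto
    have cardI: "card (line ` J) = card J" if "J \<subseteq> I" for J
      using that I inj by (meson card_image inj_on_subset subset_trans)
    show "independent_lines (line ` I)" if "I \<in> snd (T_matroid n)"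
    proof -
      have "vec.dim (\<Union>(line ` I)) \<le> card (line ` I)"
        using fin dimI by (intro dim_Union_lines_le) auto
      then show ?thesis
        using ge[OF that] cardI[of I] fin dimI by (subst independent_lines_iff_dim) auto
    qed
    show "I \<in> snd (T_matroid n)" if ind: "independent_lines (line ` I)"
    proof (rule ccontr)
      assume "I \<notin> snd (T_matroid n)"
      \<comment> \<open>More than \<open>k\<close> points of \<open>I\<close> lie in
        \<open>D\<close>, but their lines span dimension at most \<open>k\<close>.\<close>
      then obtain k D where k: "1 \<le> k" "D \<in> T_simplices n k" "k < card (I \<inter> D)"
        using I by (auto simp: T_matroid_def not_le)
      then obtain a where a: "D = {x \<in> ?T. \<forall>j. a j \<le> x j}" "(\<Sum>j\<in>UNIV. a j) + k = n"
        by (auto simp: T_simplices_def)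
      have "independent_lines (line ` (I \<inter> D))"
        using ind fin dimI by (rule_tac independent_lines_subset[of "line ` I"]) auto
      then have "vec.dim (\<Union>(line ` (I \<inter> D))) = card (line ` (I \<inter> D))"
        using fin dimI by (subst (asm) independent_lines_iff_dim) auto
      also have "\<dots> = card (I \<inter> D)" by (rule cardI) simp
      finally have "k < vec.dim (\<Union>x\<in>I \<inter> D. line x)" using k by simp
      moreover have "vec.dim (\<Union>x\<in>I \<inter> D. line x) \<le> n - (\<Sum>j\<in>UNIV. a j)"
        using I k a by (intro le) auto
      ultimately show False using a by simp
    qed
  qed
  let ?S = "line ` ?T"
  have bij: "bij_betw line ?T ?S" using inj by (simp add: bij_betw_def)
  have LM: "matroid (line_matroid ?S)"
    using dim1 finite_T_points by (intro matroid_line_matroid) auto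
  have TM: "matroid (T_matroid n :: ('d \<Rightarrow> nat) set \<times> _)"
  proof -
    have "matroid (?T, snd (T_matroid n))"
      using LM bij
      unfolding line_matroid_def
      by (rule matroid_transport) (auto simp: iff, auto simp: T_matroid_def)
    then show ?thesis by (simp add: T_matroid_def)
  qed
  show "matroid_isomorphism (inv_into ?T line) (line_matroid ?S) (T_matroid n)"
    unfolding matroid_isomorphism_def
  proof (intro conjI allI impI LM TM)
    show "bij_betw (inv_into ?T line) (fst (line_matroid ?S)) (fst (T_matroid n))"
      using bij_betw_inv_into[OF bij] by (simp add: line_matroid_def T_matroid_def)
    fix X assume "X \<subseteq> fst (line_matroid ?S)"
    then obtain I where I: "I \<subseteq> ?T" "X = line ` I"
      by (auto simp: line_matroid_def subset_image_iff)
    then have "inv_into ?T line ` X = I" using inj by (simp add: image_inv_into_cancel)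
    then show "X \<in> snd (line_matroid ?S) \<longleftrightarrow> inv_into ?T line ` X \<in> snd (T_matroid n)"
      using iff[OF I(1)] I by (auto simp: line_matroid_def)
  qed
qed

text \<open>Stars and bars: an enumeration \<open>js\<close> of the coordinates turns points into
  lists of length \<open>CARD('d)\<close> with sum \<open>n - 1\<close>.\<close>

lemma card_T_points:
  assumes "n \<ge> 1"
  shows "card (T_points n :: ('d::finite \<Rightarrow> nat) set) = (n + CARD('d) - 2) choose (CARD('d) - 1)"
proof -
  obtain js :: "'d list" where js: "set js = UNIV" "distinct js"
    using finite_distinct_list[of "UNIV :: 'd set"] by auto
  have len: "length js = CARD('d)" using js distinct_card by fastforce
  have "bij_betw (\<lambda>x. map x js) (T_points n) {l. length l = CARD('d) \<and> sum_list l = n - 1}"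
  proof (rule bij_betw_imageI)
    show "inj_on (\<lambda>x. map x js) (T_points n)"
      using js(1) by (auto intro!: inj_onI simp: fun_eq_iff)
    show "(\<lambda>x. map x js) ` T_points n = {l. length l = CARD('d) \<and> sum_list l = n - 1}"
    proof safe
      fix x :: "'d \<Rightarrow> nat" assume "x \<in> T_points n"
      then show "sum_list (map x js) = n - 1"
        using js by (auto simp: T_points_def sum_list_distinct_conv_sum_set)
    next
      fix l :: "nat list" assume l: "length l = CARD('d)" "sum_list l = n - 1"
      define x where "x j = the (map_of (zip js l) j)" for j
      have "x (js ! i) = l ! i" if "i < length js" for i
        using that js(2) l len by (simp add: x_def map_of_zip_nth)
      then have m: "map x js = l"
        using l len by (intro nth_equalityI) auto
      moreover have "x \<in> T_points n"
        using sum_list_distinct_conv_sum_set[OF js(2), of x] m l js(1) assms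
        by (simp add: T_points_def)
      ultimately show "l \<in> (\<lambda>x. map x js) ` T_points n" by blast
    qed (simp add: len)
  qed
  then have "card (T_points n :: ('d \<Rightarrow> nat) set) = (n - 1 + CARD('d) - 1) choose (n - 1)"
    by (simp add: bij_betw_same_card card_length_sum_list)
  also have "\<dots> = (n + CARD('d) - 2) choose (CARD('d) - 1)"
  proof -
    obtain k where "CARD('d) = Suc k" using not0_implies_Suc[of "CARD('d)"] by auto
    moreover obtain m where "n = Suc m" using assms by (cases n) auto
    ultimately show ?thesis using binomial_symmetric[of m "m + k"] by simp
  qed
  finally show ?thesis .
qed

section \<open>Flags, bases and dual covectors\<close>

text \<open>The numbering \<open>e\<close> of the index type mediates between bases indexed by
  numbers and matrices indexed by \<open>'n\<close>.\<close>

definition basis_matrix :: "('n \<Rightarrow> nat) \<Rightarrow> (nat \<Rightarrow> complex^'n) \<Rightarrow> complex^'n^'n" where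
  "basis_matrix e b = (\<chi> l m. b (e m) $ l)"

lemma column_basis_matrix: "column m (basis_matrix e b) = b (e m)"
  by (simp add: column_def basis_matrix_def vec_eq_iff)

lemma basis_matrix_mult: "basis_matrix e b *v w = (\<Sum>m\<in>UNIV. w $ m *s b (e m))"
  by (simp add: matrix_mult_sum column_basis_matrix)

lemma ordered_basis_if_det:
  fixes b :: "nat \<Rightarrow> complex^'n"
  assumes e: "bij_betw e (UNIV :: 'n set) {..<CARD('n)}" and det: "det (basis_matrix e b) \<noteq> 0"
  shows "ordered_basis b"
proof -
  let ?M = "basis_matrix e b"
  have ran: "b ` {..<CARD('n)} = (\<lambda>m. b (e m)) ` UNIV"
    using e by (simp add: bij_betw_def flip: image_image[of b e])
  have "inj (\<lambda>m. b (e m))"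
    using columns_if_det_nonzero(1)[OF det] by (simp add: column_basis_matrix)
  then have "card (b ` {..<CARD('n)}) = CARD('n)" by (simp add: ran card_image)
  then have "inj_on b {..<CARD('n)}" by (simp add: inj_on_iff_eq_card)
  moreover have "vec.independent (columns ?M)" by (rule columns_if_det_nonzero(2)[OF det])
  moreover have "columns ?M = b ` {..<CARD('n)}"
    unfolding ran columns_def by (auto simp: column_basis_matrix)
  ultimately show ?thesis by (simp add: ordered_basis_def)
qed

lemma subspace_flag_of_basis: "vec.subspace (flag_of_basis b k)"
  by (simp add: flag_of_basis_def vec.subspace_span)

lemma dim_flag_of_basis:
  fixes b :: "nat \<Rightarrow> complex^'n"
  assumes "ordered_basis b"
  shows "vec.dim (flag_of_basis b k) = min k CARD('n)"
proof -
  let ?S = "{..<min k CARD('n)}"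
  have sub: "b ` ?S \<subseteq> b ` {..<CARD('n)}" by auto
  then have "vec.independent (b ` ?S)"
    using assms vec.independent_mono by (auto simp: ordered_basis_def)
  moreover have "card (b ` ?S) = card ?S"
    using assms by (intro card_image) (auto simp: ordered_basis_def intro: inj_on_subset)
  ultimately show ?thesis by (simp add: flag_of_basis_def vec.dim_eq_card_independent)
qed

lemma complete_flag_of_basis:
  fixes b :: "nat \<Rightarrow> complex^'n"
  assumes "ordered_basis b"
  shows "complete_flag (flag_of_basis b)"
  unfolding complete_flag_def
proof (intro conjI allI impI)
  show "flag_of_basis b 0 = {0}" by (simp add: flag_of_basis_def)
  show "flag_of_basis b k = UNIV" if "CARD('n) \<le> k" for k
    using dim_flag_of_basis[OF assms, of k] that subspace_flag_of_basis[of b k]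
    by (intro vec.subspace_dim_equal) (auto simp: vec.dim_UNIV card_cart_basis)
  show "flag_of_basis b k \<subset> flag_of_basis b (Suc k)" if "k < CARD('n)" for k
  proof (rule psubsetI)
    show "flag_of_basis b k \<subseteq> flag_of_basis b (Suc k)"
      unfolding flag_of_basis_def by (intro vec.span_mono image_mono) auto
    show "flag_of_basis b k \<noteq> flag_of_basis b (Suc k)"
    proof
      assume "flag_of_basis b k = flag_of_basis b (Suc k)"
      then have "vec.dim (flag_of_basis b k) = vec.dim (flag_of_basis b (Suc k))" by simp
      then show False using that by (simp add: dim_flag_of_basis[OF assms])
    qed
  qed
  show "vec.subspace (flag_of_basis b k)" "vec.dim (flag_of_basis b k) = k" if "k \<le> CARD('n)" for k
    using that by (simp_all add: subspace_flag_of_basis dim_flag_of_basis[OF assms])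
qed

text \<open>Up to the factor \<open>\<delta>\<close>, \<open>f\<close> is the dual basis of
  \<open>b\<close> in reversed order. Vanishing of the first \<open>n - k\<close> covectors thus
  kills exactly the coefficients of \<open>b k\<close> and all later basis vectors.\<close>

lemma flag_of_basis_eq_kernel:
  fixes b f :: "nat \<Rightarrow> complex^'n"
  assumes e: "bij_betw e (UNIV :: 'n set) {..<CARD('n)}" and det: "det (basis_matrix e b) \<noteq> 0"
    and dual: "\<And>i m. i < CARD('n) \<Longrightarrow> m < CARD('n) \<Longrightarrow>
      pairing (f i) (b m) = (if m + i + 1 = CARD('n) then \<delta> else 0)"
    and "\<delta> \<noteq> 0" and k: "k \<le> CARD('n)"
  shows "flag_of_basis b k = {v. \<forall>i<CARD('n) - k. pairing (f i) v = 0}"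
proof
  let ?K = "{v. \<forall>i<CARD('n) - k. pairing (f i) v = 0}"
  \<comment> \<open>A single flag is treated as a family indexed by \<open>unit\<close>.\<close>
  have "?K = annihilator (\<lambda>_::unit. f) (\<lambda>_. CARD('n) - k)" by (auto simp: annihilator_def)
  then have "vec.subspace ?K" using subspace_annihilator by metis
  then show "flag_of_basis b k \<subseteq> ?K"
    unfolding flag_of_basis_def using k by (intro vec.span_minimal) (auto simp: dual)
  show "?K \<subseteq> flag_of_basis b k"
  proof
    fix v assume v: "v \<in> ?K"
    have "surj ((*v) (basis_matrix e b))"
      using det invertible_det_nz invertible_right_inverse matrix_right_invertible_surjective by blast
    then obtain w where "v = basis_matrix e b *v w" by (meson surjD)
    then have w: "v = (\<Sum>m\<in>UNIV. w $ m *s b (e m))" by (simp add: basis_matrix_mult)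
    have em: "e m < CARD('n)" for m using e by (auto simp: bij_betw_def)
    have pair: "pairing (f i) v = (\<Sum>m\<in>UNIV. w $ m * pairing (f i) (b (e m)))" for i
      unfolding w pairing_def
      by (simp add: sum_distrib_left mult_ac) (rule sum.swap)
    have *: "w $ m = 0" if m: "k \<le> e m" for m
    proof -
      let ?i = "CARD('n) - 1 - e m"
      have i: "?i < CARD('n) - k" "?i < CARD('n)" using m em[of m] by auto
      have "e m' + ?i + 1 = CARD('n) \<longleftrightarrow> m' = m" for m'
        using em[of m] inj_eq[of e m' m] e by (auto simp: bij_betw_def)
      then have "pairing (f ?i) (b (e m')) = (if m' = m then \<delta> else 0)" for m'
        using dual[OF i(2) em[of m']] by (simp only:)
      then have "pairing (f ?i) v = w $ m * \<delta>"
        by (simp add: pair if_distrib[of "\<lambda>z. _ * z"] cong: if_cong)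
      then show ?thesis using v i \<open>\<delta> \<noteq> 0\<close> by auto
    qed
    have "w $ m *s b (e m) \<in> flag_of_basis b k" for m
    proof (cases "e m < k")
      case True
      then have "b (e m) \<in> b ` {..<min k CARD('n)}" using em[of m] by simp
      then show ?thesis
        unfolding flag_of_basis_def by (intro vec.span_scale vec.span_base)
    qed (use *[of m] in \<open>simp add: flag_of_basis_def vec.span_zero\<close>)
    then show "v \<in> flag_of_basis b k"
      unfolding w using subspace_flag_of_basis by (intro vec.subspace_sum) auto
  qed
qed

section \<open>Dual covectors through the adjugate\<close>

text \<open>Column \<open>l\<close> holds the Cramer numerators for the right-hand side
  \<open>axis l 1\<close>. Unlike the inverse, the adjugate is polynomial in the entries.\<close>

definition adjugate :: "complex^'n^'n \<Rightarrow> complex^'n^'n" where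
  "adjugate B = (\<chi> k l. det (\<chi> p q. if q = k then axis l 1 $ p else B $ p $ q))"

text \<open>Cramer's rule gives the product in the other order; a left inverse of \<open>B\<close>
  and the centrality of scalar matrices reverse it.\<close>

lemma adjugate_mult:
  fixes B :: "complex^'n^'n"
  assumes "det B \<noteq> 0"
  shows "adjugate B ** B = mat (det B)"
proof -
  have "(B ** adjugate B) $ i $ l = (if i = l then det B else 0)" for i l
  proof -
    let ?w = "\<chi> k. det (\<chi> p q. if q = k then axis l 1 $ p else B $ p $ q)"
    have "(B ** adjugate B) $ i $ l = (B *v ?w) $ i"
      by (simp add: matrix_matrix_mult_def matrix_vector_mult_def adjugate_def)
    also have "\<dots> = (det B *s axis l 1) $ i" using det_scaled_solution(1)[OF assms refl] by simp
    finally show ?thesis by (simp add: axis_def)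
  qed
  then have BA: "B ** adjugate B = mat (det B)" by (simp add: vec_eq_iff mat_def)
  obtain C where C: "C ** B = mat 1"
    using assms invertible_det_nz invertible_left_inverse by blast
  have *: "X ** mat c = mat c ** X" for c and X :: "complex^'n^'n"
    by (simp add: vec_eq_iff mat_def matrix_matrix_mult_def if_distrib if_distribR
        cong: if_cong)
  have "adjugate B = (C ** B) ** adjugate B" by (simp add: C)
  also have "\<dots> = C ** mat (det B)" by (simp add: BA flip: matrix_mul_assoc)
  also have "\<dots> = mat (det B) ** C" by (simp add: *)
  finally show ?thesis by (simp add: C flip: matrix_mul_assoc)
qed

lemma adjugate_left_inverse:
  fixes B R :: "complex^'n^'n"
  assumes "R ** B = mat 1"
  shows "adjugate B $ i = det B *s (R $ i)"
proof -
  have BR: "B ** R = mat 1" using assms matrix_left_right_inverse by blast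
  then have "det B * det R = 1" by (metis det_I det_mul)
  then have det: "det B \<noteq> 0" by auto
  have "adjugate B = (adjugate B ** B) ** R" by (simp add: BR flip: matrix_mul_assoc)
  also have "\<dots> = mat (det B) ** R" by (simp add: adjugate_mult[OF det])
  finally have "adjugate B $ i $ l = (mat (det B) ** R) $ i $ l" for l by simp
  then show ?thesis
    by (simp add: vec_eq_iff mat_def matrix_matrix_mult_def if_distrib if_distribR cong: if_cong)
qed

text \<open>The rows are taken in reversed order because the covector of index 0 must vanish on all
  basis vectors but the last. The constant \<open>c\<close> allows a prescribed
  normalisation.\<close>

definition adjugate_covector ::
    "('n \<Rightarrow> nat) \<Rightarrow> complex \<Rightarrow> (nat \<Rightarrow> complex^'n) \<Rightarrow> nat \<Rightarrow> complex^'n" where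
  "adjugate_covector e c b i =
     c *s row (inv e (CARD('n) - 1 - i)) (adjugate (basis_matrix e b))"

lemma pairing_adjugate_covector:
  fixes b :: "nat \<Rightarrow> complex^'n"
  assumes e: "bij_betw e (UNIV :: 'n set) {..<CARD('n)}" and det: "det (basis_matrix e b) \<noteq> 0"
    and i: "i < CARD('n)" and m: "m < CARD('n)"
  shows "pairing (adjugate_covector e c b i) (b m) =
    (if m + i + 1 = CARD('n) then c * det (basis_matrix e b) else 0)"
proof -
  let ?B = "basis_matrix e b"
  have inv: "e (inv e k) = k" if "k < CARD('n)" for k
    using e that by (intro f_inv_into_f) (auto simp: bij_betw_def)
  have "pairing (adjugate_covector e c b i) (b m) =
      c * (adjugate ?B ** ?B) $ inv e (CARD('n) - 1 - i) $ inv e m"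
    by (simp add: adjugate_covector_def pairing_def row_def matrix_matrix_mult_def
        sum_distrib_left basis_matrix_def inv[OF m] mult.assoc)
  also have "\<dots> = (if inv e (CARD('n) - 1 - i) = inv e m then c * det ?B else 0)"
    by (simp add: adjugate_mult[OF det] mat_def)
  also have "inv e (CARD('n) - 1 - i) = inv e m \<longleftrightarrow> CARD('n) - 1 - i = m"
    using inv[OF m] inv[of "CARD('n) - 1 - i"] i by (metis One_nat_def diff_less_Suc diff_Suc_less diff_diff_left m le_less_trans diff_le_self plus_1_eq_Suc zero_less_card_finite)
  also have "CARD('n) - 1 - i = m \<longleftrightarrow> m + i + 1 = CARD('n)" using i by auto
  finally show ?thesis .
qed

lemma polynomial_in_entries_adjugate_covector:
  fixes j :: 'd
  assumes e: "bij_betw e (UNIV :: 'n::finite set) {..<CARD('n)}"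
  shows "polynomial_in_entries
    (\<lambda>b :: 'd \<Rightarrow> nat \<Rightarrow> complex^'n. adjugate_covector e c (b j) i $ l)"
proof -
  let ?C = "\<lambda>b :: 'd \<Rightarrow> nat \<Rightarrow> complex^'n. \<chi> p q.
     if q = inv e (CARD('n) - 1 - i) then axis l 1 $ p else basis_matrix e (b j) $ p $ q"
  have em: "e m < CARD('n)" for m using e by (auto simp: bij_betw_def)
  have "polynomial_in_entries (\<lambda>b. ?C b $ p $ q)" for p q
    by (cases "q = inv e (CARD('n) - 1 - i)")
      (simp_all add: basis_matrix_def polynomial_in_entries.const polynomial_in_entries.entry em)
  then have "polynomial_in_entries (\<lambda>b. det (?C b))"
    by (rule polynomial_in_entries_det[of ?C])
  then show ?thesis
    by (simp add: adjugate_covector_def adjugate_def row_def polynomial_in_entries.mult polynomial_in_entries.const)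
qed

lemma span_image_expansion:
  fixes b :: "nat \<Rightarrow> complex^'n"
  assumes "v \<in> vec.span (b ` S)" and "finite S" and "inj_on b S"
  shows "\<exists>\<gamma>. v = (\<Sum>m\<in>S. \<gamma> m *s b m)"
proof -
  obtain u where "v = (\<Sum>w\<in>b ` S. u w *s w)"
    using assms by (auto simp: vec.span_finite)
  also have "\<dots> = (\<Sum>m\<in>S. u (b m) *s b m)" using assms(3) by (simp add: sum.reindex)
  finally show ?thesis by (intro exI[of _ "\<lambda>m. u (b m)"])
qed

section \<open>Open sets of flags\<close>

text \<open>The right action of upper triangular matrices on tuples of bases. Invertibility of the
  coefficients is not built in; below it is enforced by \<open>p\<close> being nonzero only on
  ordered bases.\<close>

definition triangular_change ::
    "('d \<Rightarrow> nat \<Rightarrow> nat \<Rightarrow> complex) \<Rightarrow> ('d \<Rightarrow> nat \<Rightarrow> complex^'n) \<Rightarrow> 'd \<Rightarrow> nat \<Rightarrow> complex^'n" where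
  "triangular_change \<gamma> b j i = (\<Sum>m\<le>i. \<gamma> j i m *s b j m)"

text \<open>The preimage in \<open>(GL\<^sub>n)\<^sup>d\<close> is the union, over upper triangular \<open>g\<close>, of the
  sets \<open>p (b g) \<noteq> 0\<close>.\<close>

lemma zariski_open_image_of_basic:
  fixes p :: "('d \<Rightarrow> nat \<Rightarrow> complex^'n) \<Rightarrow> complex"
  assumes p: "polynomial_in_entries p"
    and basis: "\<And>b j. p b \<noteq> 0 \<Longrightarrow> ordered_basis (b j)"
  shows "zariski_open_flags {\<lambda>j. flag_of_basis (b j) | b. p b \<noteq> 0}" (is "zariski_open_flags ?U")
  unfolding zariski_open_flags_def
proof (intro conjI ballI allI exI[of _ "range (\<lambda>\<gamma> b. p (triangular_change \<gamma> b))"] impI)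
  show "complete_flag (E j)" if "E \<in> ?U" for E j
    using that basis complete_flag_of_basis by auto
  show "polynomial_in_entries q" if q_in: "q \<in> range (\<lambda>\<gamma> b. p (triangular_change \<gamma> b))" for q
  proof -
    obtain \<gamma> where q: "q = (\<lambda>b. p (triangular_change \<gamma> b))" using q_in by blast
    have "polynomial_in_entries (\<lambda>b :: 'd \<Rightarrow> nat \<Rightarrow> complex^'n. triangular_change \<gamma> b j i $ l)"
      if "i < CARD('n)" for j i l
      unfolding triangular_change_def sum_component vector_smult_component using that
      by (intro polynomial_in_entries_sum polynomial_in_entries.mult polynomial_in_entries.const
          polynomial_in_entries.entry) auto
    then show ?thesis unfolding q by (rule polynomial_in_entries_compose[OF p])
  qed
  fix b :: "'d \<Rightarrow> nat \<Rightarrow> complex^'n" assume b: "\<forall>j. ordered_basis (b j)"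
  show "(\<lambda>j. flag_of_basis (b j)) \<in> ?U \<longleftrightarrow>
      (\<exists>q\<in>range (\<lambda>\<gamma> b. p (triangular_change \<gamma> b)). q b \<noteq> 0)"
  proof
    assume "(\<lambda>j. flag_of_basis (b j)) \<in> ?U"
    then obtain c where c: "p c \<noteq> 0" "\<And>j. flag_of_basis (b j) = flag_of_basis (c j)"
      by (auto simp: fun_eq_iff)
    have ex: "\<exists>\<gamma>. c j i = (\<Sum>m\<le>i. \<gamma> m *s b j m)" if i: "i < CARD('n)" for j i
    proof -
      have "c j i \<in> flag_of_basis (b j) (Suc i)"
        unfolding c(2) flag_of_basis_def using i by (intro vec.span_base) auto
      moreover have "{..<min (Suc i) CARD('n)} = {..i}" using i by auto
      moreover have "inj_on (b j) {..i}"
        using b i by (auto simp: ordered_basis_def intro: inj_on_subset)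
      ultimately show ?thesis
        unfolding flag_of_basis_def by (intro span_image_expansion) auto
    qed
    define \<gamma> where "\<gamma> j i = (SOME \<gamma>. c j i = (\<Sum>m\<le>i. \<gamma> m *s b j m))" for j i
    have "c j i = (\<Sum>m\<le>i. \<gamma> j i m *s b j m)" if "i < CARD('n)" for j i
      unfolding \<gamma>_def by (rule someI_ex[OF ex[OF that]])
    \<comment> \<open>The two tuples may differ at indices from \<open>CARD('n)\<close> on, which
      \<open>p\<close> does not see.\<close>
    then have "p (triangular_change \<gamma> b) = p c"
      by (intro polynomial_in_entries_cong[OF p]) (simp add: triangular_change_def)
    then show "\<exists>q\<in>range (\<lambda>\<gamma> b. p (triangular_change \<gamma> b)). q b \<noteq> 0"
      using c(1) by (intro bexI[OF _ rangeI[of _ \<gamma>]]) simp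
  next
    assume "\<exists>q\<in>range (\<lambda>\<gamma> b. p (triangular_change \<gamma> b)). q b \<noteq> 0"
    then obtain \<gamma> where \<gamma>: "p (triangular_change \<gamma> b) \<noteq> 0" by blast
    let ?c = "triangular_change \<gamma> b"
    \<comment> \<open>Triangularity gives the inclusion; equal dimensions, both tuples consisting of
      ordered bases, give equality.\<close>
    have "flag_of_basis (?c j) k = flag_of_basis (b j) k" for j k
    proof (rule vec.subspace_dim_equal)
      show "flag_of_basis (?c j) k \<subseteq> flag_of_basis (b j) k"
        unfolding flag_of_basis_def
      proof (intro vec.span_minimal vec.subspace_span)
        show "?c j ` {..<min k CARD('n)} \<subseteq> vec.span (b j ` {..<min k CARD('n)})"
          unfolding triangular_change_def
          by (intro image_subsetI vec.span_sum vec.span_scale vec.span_base) auto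
      qed
      show "vec.dim (flag_of_basis (b j) k) \<le> vec.dim (flag_of_basis (?c j) k)"
        using b basis[OF \<gamma>] by (simp add: dim_flag_of_basis)
    qed (rule subspace_flag_of_basis)+
    then have "(\<lambda>j. flag_of_basis (b j)) = (\<lambda>j. flag_of_basis (?c j))"
      by (auto simp: fun_eq_iff)
    then show "(\<lambda>j. flag_of_basis (b j)) \<in> ?U" using \<gamma> by blast
  qed
qed

text \<open>Passing from bases to adjugate covectors is a polynomial map, so a generic condition on
  covectors pulls back to a principal open set of bases, whose image in the flags is open.
  Nonemptiness needs a basis realising a given generic \<open>f\<close>, found by inverting the
  matrices of covectors.\<close>

lemma for_generic_flags_if_generic_covectors:
  fixes \<Phi> :: "('d::finite \<Rightarrow> nat \<Rightarrow> complex^'n) \<Rightarrow> bool"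
  assumes \<Phi>: "generic_tuple \<Phi>"
    and Q: "\<And>f E. \<Phi> f \<Longrightarrow>
      (\<And>j k. k \<le> CARD('n) \<Longrightarrow> E j k = {v. \<forall>i<CARD('n) - k. pairing (f j i) v = 0}) \<Longrightarrow> Q E"
  shows "for_generic_flags Q"
proof -
  obtain e where e: "bij_betw e (UNIV :: 'n set) {..<CARD('n)}"
    using finite_same_card_bij[of "UNIV :: 'n set" "{..<CARD('n)}"] by auto
  have em: "e m < CARD('n)" and inv_e: "inv e (e m) = m" for m
    using e by (auto simp: bij_betw_def)
  have e_inv: "e (inv e k) = k" if "k < CARD('n)" for k
    using e that by (intro f_inv_into_f) (auto simp: bij_betw_def)
  \<comment> \<open>The covectors of flag \<open>j\<close> as rows, in the same reversed order as in
    \<open>adjugate_covector\<close>.\<close>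
  define R where "R f j = (\<chi> m. f j (CARD('n) - 1 - e m))"
    for f :: "'d \<Rightarrow> nat \<Rightarrow> complex^'n" and j
  have "generic_tuple (\<lambda>f. \<forall>j\<in>UNIV. det (R f j) \<noteq> 0)"
  proof (intro generic_tuple_ball finite)
    fix j
    have "polynomial_in_entries (\<lambda>f. R f j $ i $ k)" for i k
      by (simp add: R_def polynomial_in_entries.entry)
    moreover have "R (\<lambda>j i. axis (inv e (CARD('n) - 1 - i)) 1) j = mat 1"
      using em inv_e by (simp add: R_def vec_eq_iff mat_def axis_def Suc_leI)
    then have "det (R (\<lambda>j i. axis (inv e (CARD('n) - 1 - i)) 1) j) \<noteq> 0" by simp
    ultimately show "generic_tuple (\<lambda>f. det (R f j) \<noteq> 0)"
      by (rule generic_tuple_det[of "\<lambda>f. R f j"])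
  qed
  with \<Phi> have "generic_tuple (\<lambda>f. \<Phi> f \<and> (\<forall>j\<in>UNIV. det (R f j) \<noteq> 0))"
    by (rule generic_tuple_conj)
  then obtain q f where q: "polynomial_in_entries q" "\<And>f. q f \<noteq> 0 \<Longrightarrow> \<Phi> f"
    and f: "q f \<noteq> 0" "\<And>j. det (R f j) \<noteq> 0"
    unfolding generic_tuple_def by auto
  have "\<exists>B. R f j ** B = mat 1" for j
    using f(2)[of j] by (metis invertible_det_nz invertible_right_inverse)
  then obtain B where B: "\<And>j. R f j ** B j = mat 1" by metis
  define b0 where "b0 j i = column (inv e i) (B j)" for j i
  have B_eq: "basis_matrix e (b0 j) = B j" for j
    by (simp add: basis_matrix_def b0_def inv_e column_def vec_eq_iff)
  have detB: "det (B j) \<noteq> 0" for j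
    using B[of j] by (metis det_I det_mul mult_zero_right zero_neq_one)
  \<comment> \<open>The scalar is a constant fixed by the base point \<open>b0\<close>, so
    \<open>g\<close> stays polynomial in \<open>b\<close>, and it normalises \<open>g b0\<close> to
    \<open>f\<close>.\<close>
  define g where "g b j i = adjugate_covector e (1 / det (B j)) (b j) i"
    for b :: "'d \<Rightarrow> nat \<Rightarrow> complex^'n" and j i
  \<comment> \<open>The determinant factors confine the open set to tuples of bases.\<close>
  define p where "p b = (\<Prod>j\<in>UNIV. det (basis_matrix e (b j))) * q (g b)" for b
  have "g b0 j i = f j i" if "i < CARD('n)" for j i
  proof -
    have "g b0 j i = R f j $ inv e (CARD('n) - 1 - i)"
      using detB[of j]
      by (simp add: g_def adjugate_covector_def B_eq row_def adjugate_left_inverse[OF B] vec_eq_iff)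
    also have "\<dots> = f j i" using that by (simp add: R_def e_inv)
    finally show ?thesis .
  qed
  then have "q (g b0) = q f" by (intro polynomial_in_entries_cong[OF q(1)])
  then have p_b0: "p b0 \<noteq> 0" using f(1) detB by (simp add: p_def B_eq)
  have "polynomial_in_entries (\<lambda>b :: 'd \<Rightarrow> nat \<Rightarrow> complex^'n. basis_matrix e (b j) $ i $ k)"
    for j i k by (simp add: basis_matrix_def em polynomial_in_entries.entry)
  then have "polynomial_in_entries (\<lambda>b :: 'd \<Rightarrow> nat \<Rightarrow> complex^'n. det (basis_matrix e (b j)))"
    for j by (rule polynomial_in_entries_det[of "\<lambda>b. basis_matrix e (b j)"])
  moreover have "polynomial_in_entries (\<lambda>b. q (g b))"
    using polynomial_in_entries_adjugate_covector[OF e]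
    by (intro polynomial_in_entries_compose[OF q(1)]) (simp add: g_def)
  ultimately have p: "polynomial_in_entries p"
    unfolding p_def by (intro polynomial_in_entries.mult polynomial_in_entries_prod)
  have p_det: "det (basis_matrix e (b j)) \<noteq> 0" if "p b \<noteq> 0" for b j
    using that by (auto simp: p_def)
  have "ordered_basis (b j)" if "p b \<noteq> 0" for b j
    by (rule ordered_basis_if_det[OF e p_det[OF that]])
  then have "zariski_open_flags {\<lambda>j. flag_of_basis (b j) | b. p b \<noteq> 0}"
    by (rule zariski_open_image_of_basic[OF p])
  moreover have "Q (\<lambda>j. flag_of_basis (b j))" if "p b \<noteq> 0" for b
  proof (rule Q[of "g b"])
    show "\<Phi> (g b)" using that q(2) by (simp add: p_def)
    show "flag_of_basis (b j) k = {v. \<forall>i<CARD('n) - k. pairing (g b j i) v = 0}"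
      if "k \<le> CARD('n)" for j k
      using pairing_adjugate_covector[OF e p_det[OF \<open>p b \<noteq> 0\<close>]] detB p_det[OF \<open>p b \<noteq> 0\<close>] that
      unfolding g_def
      by (intro flag_of_basis_eq_kernel[OF e p_det[OF \<open>p b \<noteq> 0\<close>],
            where \<delta> = "1 / det (B j) * det (basis_matrix e (b j))"]) auto
  qed
  ultimately show ?thesis
    unfolding for_generic_flags_def using p_b0
    by (intro exI[of _ "{\<lambda>j. flag_of_basis (b j) | b. p b \<noteq> 0}"]) auto
qed

section \<open>Line indices, lattice points and the theorem\<close>

text \<open>The coordinate sum becomes \<open>d * n - ((d - 1) * n + 1)\<close>, that is,
  \<open>n - 1\<close>.\<close>

lemma line_indices_complement:
  fixes a :: "'d::finite \<Rightarrow> nat"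
  assumes "a \<in> line_indices n"
  shows "(\<lambda>i. n - a i) \<in> T_points n"
proof -
  have le: "a i \<le> n" for i using assms by (simp add: line_indices_def)
  obtain k where k: "CARD('d) = Suc k" using not0_implies_Suc[of "CARD('d)"] by auto
  have "(\<Sum>i\<in>UNIV. n - a i) + (\<Sum>i\<in>UNIV. a i) = (\<Sum>i\<in>(UNIV :: 'd set). n)"
    using le by (simp flip: sum.distrib)
  then show ?thesis using assms by (simp add: line_indices_def T_points_def k)
qed

lemma T_points_complement:
  fixes x :: "'d::finite \<Rightarrow> nat"
  assumes "x \<in> T_points n"
  shows "(\<lambda>i. n - x i) \<in> line_indices n"
proof -
  have less: "x i < n" for i
  proof -
    have "x i \<le> (\<Sum>i\<in>UNIV. x i)" by (rule member_le_sum) auto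
    then show ?thesis using assms by (simp add: T_points_def)
  qed
  obtain k where k: "CARD('d) = Suc k" using not0_implies_Suc[of "CARD('d)"] by auto
  have "(\<Sum>i\<in>UNIV. n - x i) + (\<Sum>i\<in>UNIV. x i) = (\<Sum>i\<in>(UNIV :: 'd set). n)"
    using less by (simp add: less_imp_le flip: sum.distrib)
  then show ?thesis using assms less
    by (auto simp: line_indices_def T_points_def k Suc_le_eq)
qed

theorem theorem5p1:
  fixes n d :: nat
  assumes "CARD('n::finite) = n" and "CARD('d::finite) = d"
  shows "for_generic_flags (\<lambda>E :: 'd \<Rightarrow> nat \<Rightarrow> (complex^'n) set.
    (\<forall>a\<in>line_indices n. vec.dim (flag_meet E a) = 1) \<and>
    card (flag_lines E) = (n + d - 2) choose (d - 1) \<and>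
    (\<exists>\<phi>. matroid_isomorphism \<phi> (line_matroid (flag_lines E))
            (T_matroid n :: ('d \<Rightarrow> nat) set \<times> ('d \<Rightarrow> nat) set set) \<and>
         (\<forall>a\<in>line_indices n. \<phi> (flag_meet E a) = (\<lambda>i. n - a i))))"
proof -
  let ?T = "T_points n :: ('d \<Rightarrow> nat) set" and ?\<I> = "snd (T_matroid n) :: ('d \<Rightarrow> nat) set set"
  let ?\<Phi> = "\<lambda>f :: 'd \<Rightarrow> nat \<Rightarrow> complex^'n. \<forall>I\<in>?\<I>.
    card I \<le> vec.dim (\<Union>x\<in>I. annihilator f x) \<and>
    (\<forall>x\<in>I. annihilator f x \<noteq> {0} \<and>
       (\<forall>a. (\<forall>j. a j \<le> x j) \<longrightarrow> vec.dim (annihilator f a) \<le> n - (\<Sum>j\<in>UNIV. a j)))"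
  \<comment> \<open>There are finitely many independent sets, so their generic conditions can be
    imposed together.\<close>
  have "?\<I> \<subseteq> Pow ?T" by (auto simp: T_matroid_def)
  then have "finite ?\<I>" using finite_T_points finite_subset by (metis finite_Pow_iff)
  then have "generic_tuple ?\<Phi>"
    using generic_covectors assms(1) by (intro generic_tuple_ball) auto
  then show ?thesis
  proof (rule for_generic_flags_if_generic_covectors)
    fix f and E :: "'d \<Rightarrow> nat \<Rightarrow> (complex^'n) set"
    assume \<Phi>: "?\<Phi> f"
      and E: "\<And>j k. k \<le> CARD('n) \<Longrightarrow> E j k = {v. \<forall>i<CARD('n) - k. pairing (f j i) v = 0}"
    let ?line = "annihilator f"
    \<comment> \<open>Every singleton is independent, so the dimension bound is available at every
      point.\<close>
    have le: "vec.dim (?line a) \<le> n - (\<Sum>j\<in>UNIV. a j)" if "x \<in> ?T" "\<And>j. a j \<le> x j" for x a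
      using \<Phi> T_independent_singleton[OF that(1)] that(2) by blast
    have dim1: "vec.dim (?line x) = 1" if x: "x \<in> ?T" for x
    proof -
      have "0 \<in> ?line x" by (simp add: annihilator_def pairing_def)
      moreover have "?line x \<noteq> {0}" using \<Phi> T_independent_singleton[OF x] by blast
      ultimately have "\<not> ?line x \<subseteq> {0}" by blast
      then have "1 \<le> vec.dim (?line x)" by (metis less_one not_le vec.dim_eq_0)
      moreover have "vec.dim (?line x) \<le> n - (\<Sum>j\<in>UNIV. x j)" using x by (intro le) auto
      then have "vec.dim (?line x) \<le> 1" using x by (simp add: T_points_def)
      ultimately show ?thesis by (rule antisym[rotated])
    qed
    have "vec.dim (\<Union>x\<in>I. ?line x) \<le> n - (\<Sum>j\<in>UNIV. a j)"
      if "I \<subseteq> ?T" "I \<noteq> {}" "\<And>x j. x \<in> I \<Longrightarrow> a j \<le> x j" for I a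
    proof -
      obtain x where "x \<in> I" using \<open>I \<noteq> {}\<close> by blast
      \<comment> \<open>A larger point imposes more covectors, so all lines of the simplex lie in
        the annihilator of its corner.\<close>
      have "(\<Union>x\<in>I. ?line x) \<subseteq> ?line a"
        unfolding annihilator_def using less_le_trans[OF _ that(3)] by blast
      then have "vec.dim (\<Union>x\<in>I. ?line x) \<le> vec.dim (?line a)" by (rule vec.dim_subset)
      also have "\<dots> \<le> n - (\<Sum>j\<in>UNIV. a j)" using that \<open>x \<in> I\<close> by (intro le[of x]) auto
      finally show ?thesis .
    qed
    moreover have "card I \<le> vec.dim (\<Union>x\<in>I. ?line x)" if "I \<in> ?\<I>" for I
      using \<Phi> that by blast
    ultimately have inj: "inj_on ?line ?T"
      and iso: "matroid_isomorphism (inv_into ?T ?line) (line_matroid (?line ` ?T)) (T_matroid n)"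
      using line_matroid_T_matroid[of n ?line] dim1 by blast+
    \<comment> \<open>The member \<open>E j (a j)\<close> is cut out by the first
      \<open>n - a j\<close> covectors of flag \<open>j\<close>.\<close>
    have meet: "flag_meet E a = ?line (\<lambda>i. n - a i)" if "a \<in> line_indices n" for a
    proof -
      have "a j \<le> CARD('n)" for j using that assms(1) by (simp add: line_indices_def)
      then show ?thesis
        using assms(1) by (auto simp: flag_meet_def annihilator_def E)
    qed
    have lines: "flag_lines E = ?line ` ?T"
    proof
      show "flag_lines E \<subseteq> ?line ` ?T"
        unfolding flag_lines_def
      proof (rule image_subsetI)
        fix a :: "'d \<Rightarrow> nat" assume "a \<in> line_indices CARD('n)"
        then have "a \<in> line_indices n" using assms(1) by simp
        then show "flag_meet E a \<in> ?line ` ?T"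
          by (simp add: meet line_indices_complement)
      qed
      show "?line ` ?T \<subseteq> flag_lines E"
      proof safe
        fix x :: "'d \<Rightarrow> nat" assume x: "x \<in> ?T"
        have "x i \<le> n" for i
        proof -
          have "x i \<le> (\<Sum>i\<in>UNIV. x i)" by (rule member_le_sum) auto
          then show ?thesis using x by (simp add: T_points_def)
        qed
        then have "flag_meet E (\<lambda>i. n - x i) = ?line x"
          using meet[OF T_points_complement[OF x]] by simp
        then show "?line x \<in> flag_lines E"
          using T_points_complement[OF x] assms(1) unfolding flag_lines_def by (metis imageI)
      qed
    qed
    have "n \<ge> 1" using assms(1) by (metis One_nat_def Suc_leI zero_less_card_finite)
    then have "card (flag_lines E) = (n + d - 2) choose (d - 1)"
      unfolding lines using inj card_T_points[where 'd='d] assms(2) by (simp add: card_image)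
    moreover have "\<forall>a\<in>line_indices n. vec.dim (flag_meet E a) = 1"
    proof
      fix a :: "'d \<Rightarrow> nat" assume a: "a \<in> line_indices n"
      show "vec.dim (flag_meet E a) = 1"
        unfolding meet[OF a] by (rule dim1[OF line_indices_complement[OF a]])
    qed
    moreover have "\<forall>a\<in>line_indices n. inv_into ?T ?line (flag_meet E a) = (\<lambda>i. n - a i)"
    proof
      fix a :: "'d \<Rightarrow> nat" assume a: "a \<in> line_indices n"
      show "inv_into ?T ?line (flag_meet E a) = (\<lambda>i. n - a i)"
        unfolding meet[OF a] by (rule inv_into_f_f[OF inj line_indices_complement[OF a]])
    qed
    ultimately show "(\<forall>a\<in>line_indices n. vec.dim (flag_meet E a) = 1) \<and>
      card (flag_lines E) = (n + d - 2) choose (d - 1) \<and>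
      (\<exists>\<phi>. matroid_isomorphism \<phi> (line_matroid (flag_lines E))
              (T_matroid n :: ('d \<Rightarrow> nat) set \<times> ('d \<Rightarrow> nat) set set) \<and>
           (\<forall>a\<in>line_indices n. \<phi> (flag_meet E a) = (\<lambda>i. n - a i)))"
      using iso unfolding lines by blast
  qed
qed

end
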